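(* Assume that the collision kernel has separated form with exponent $\beta\in(1-D,1]$. Let $\mathcal M$ be a global Maxwellian such that $\nu(\mathcal M)<\tfrac14$. (a) For each $F^{\mathrm{in}}\in\mathcal Y_{\mathcal M(0)}$ such that $$|F^{\mathrm{in}}-\mathcal M(0)|_{\mathcal M(0)}<\frac{(1-4\nu(\mathcal M))^2}{8\nu(\mathcal M)},$$ there exists a unique mild solution $F\in\mathcal X_{\mathcal M}$ (on $\mathbb R^D\times\mathbb R^D\times\mathbb R$) of the Boltzmann equation such that $$F(0)=F^{\mathrm{in}}\quad\text{and}\quad\|F-\mathcal M\|_{\mathcal M}\le r,$$ with $$r=\left(\frac1{4\nu(\mathcal M)}-1\right)\left(1-\sqrt{1-\frac{8\nu(\mathcal M)\,|F^{\mathrm{in}}-\mathcal M(0)|_{\mathcal M(0)}}{(1-4\nu(\mathcal M))^2}}\right).$$ (b) Moreover, if $\tfrac12\le4\nu(\mathcal M)<1$, or if $0<4\nu(\mathcal M)<\tfrac12$ and $|F^{\mathrm{in}}-\mathcal M(0)|_{\mathcal M(0)}\le1-6\nu(\mathcal M)$, then $r\le1$ and therefore $$0\le(1-r)\mathcal M(v,x,t)\le F(v,x,t)\le(1+r)\mathcal M(v,x,t)\quad\text{for a.e. }(v,x,t)\in\mathbb R^D\times\mathbb R^D\times\mathbb R.$$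
   Context: Collision kernel and collision integral. $D\ge1$ is an integer. A collision kernel of separated form with exponent $\beta$ is $\mathsf b(z,\omega)=|z|^\beta\hat{\mathsf b}(\omega\cdot z/|z|)$, $z\in\mathbb R^D$, $\omega\in\mathbb S^{D-1}$, where $\hat{\mathsf b}\ge0$ is measurable and $0<\bar{\mathsf b}:=\int_{\mathbb S^{D-1}}\hat{\mathsf b}(\omega\cdot n)\,d\omega<\infty$ ($n$ any unit vector). With $v'=v-((v-v_* )\cdot\omega)\omega$ and $v_*'=v_*+((v-v_* )\cdot\omega)\omega$, the collision integral is $$\mathcal B(F,F)(v,x,t)=\iint_{\mathbb S^{D-1}\times\mathbb R^D}\big(F(v',x,t)F(v'_*,x,t)-F(v,x,t)F(v_*,x,t)\big)\mathsf b(v-v_*,\omega)\,d\omega\,dv_*,$$ and $\mathcal A(F)(v,x,t):=\bar{\mathsf b}\int_{\mathbb R^D}F(v_*,x,t)|v-v_*|^\beta\,dv_*$. The Boltzmann equation is $\partial_tF+v\cdot\nabla_xF=\mathcal B(F,F)$. Functions $F$ are real valued (not assumed nonnegative). Global Maxwellians (of finite mass) are the functions $$\mathcal M(v,x,t)=\frac{m}{(2\pi)^D}\sqrt{\det Q}\;e^{-q(v-v_0,x-x_0,t)},\qquad q(v,x,t)=\tfrac12\big(c|v|^2+a|x-tv|^2+2b(x-tv)\cdot v\big)-v\cdot B(x-tv),$$ with $m,a,c>0$, $b\in\mathbb R$, $x_0,v_0\in\mathbb R^D$, $B$ a real skew-symmetric $D\times D$ matrix such that $Q:=(ac-b^2)I+B^2$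 is positive definite. They satisfy $\partial_t\mathcal M+v\cdot\nabla_x\mathcal M=0$ and $\mathcal B(\mathcal M,\mathcal M)=0$. $\mathcal M(t)$ denotes $(v,x)\mapsto\mathcal M(v,x,t)$. The constant $\nu$: for $\beta\in(1-D,1]$, $$\nu(\mathcal M):=\sup_{(v,x,t)\in\mathbb R^D\times\mathbb R^D\times\mathbb R}\left|\int_{\mathbb R}\mathcal A(\mathcal M)(v,x-tv+sv,s)\,ds\right|,$$ which is finite. Spaces: $\mathcal X_{\mathcal M}:=\mathcal M L^\infty(\mathbb R^D\times\mathbb R^D\times\mathbb R)$ with norm $\|F\|_{\mathcal M}:=\|F/\mathcal M\|_{L^\infty}$; $\mathcal Y_{\mathcal M(0)}:=\mathcal M(0)L^\infty(\mathbb R^D\times\mathbb R^D)$ with norm $|f|_{\mathcal M(0)}:=\|f/\mathcal M(0)\|_{L^\infty}$. Mild solutions: $e^{t\mathsf A}$ is defined by $(e^{t\mathsf A}\phi)(v,x)=\phi(v,x+tv)$. A mild solution on $\mathbb R^D\times\mathbb R^D\times I$ ($I\subset\mathbb R$ an interval) is $F\in L^1_{loc}(\mathbb R^D\times\mathbb R^D\times I)$ with $\mathcal B(F,F)\in L^1_{loc}(\mathbb R^D\times\mathbb R^D\times I)$ and $$e^{t_2\mathsf A}F(v,x,t_2)=e^{t_1\mathsf A}F(v,x,t_1)+\int_{t_1}^{t_2}e^{s\mathsf A}\mathcal B(F,F)(v,x,s)\,ds$$ for a.e. $(v,x)\in\mathbb R^D\times\mathbb R^D$ and all $t_1,t_2\in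 I$. $F$ is identified with its representative in $C(I;L^1_{loc}(\mathbb R^D\times\mathbb R^D))$, and $F(t)$ denotes $(v,x)\mapsto F(v,x,t)$.
   Formalization: Global Maxwellians are taken with exponent q(v−v0, x−x0−t v0, t) instead of q(v−v0, x−x0, t); for v0≠0 the printed formula does not solve the free transport equation, and the theorem fails for it with F^in=M(0). *)

theory Defs
  imports "HOL-Analysis.Analysis" "HOL-Probability.Essential_Supremum"
begin

text \<open>
  Velocities and positions live in \<^typ>\<open>real ^ 'n\<close>, so the dimension D is \<open>CARD('n) \<ge> 1\<close>.
  A function of (v,x) or (v,x,t) takes a tuple. Elements of the L-infinity and L-1-loc
  spaces are represented by Borel functions (every Lebesgue class has a Borel
  representative); equality of such elements is equality almost everywhere.
\<close>

type_synonym 'n phase = "(real ^ 'n) \<times> (real ^ 'n)"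
type_synonym 'n phase_time = "(real ^ 'n) \<times> (real ^ 'n) \<times> real"

text \<open>
  Surface measure on the unit sphere, in polar form: the mass of A is D times the volume of
  the cone {r y. 0 < r < 1, y in A}. For D = 1 it is the counting measure on {-1, 1}.
\<close>

definition sphere_measure :: "(real ^ 'n) measure" where
  "sphere_measure =
     distr (scale_measure (of_nat CARD('n)) (restrict_space lborel (ball 0 1 - {0})))
           (restrict_space borel (sphere 0 1)) sgn"

lemma emeasure_sphere_measure:
  fixes A :: "(real ^ 'n) set"
  assumes "A \<in> sets borel" "A \<subseteq> sphere 0 1"
  shows "emeasure sphere_measure A =
    of_nat CARD('n) * emeasure lborel {x \<in> ball 0 1 - {0}. sgn x \<in> A}"
proof -
  let ?R = "restrict_space lborel (ball 0 1 - {0}) :: (real ^ 'n) measure"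
  have m: "sgn \<in> measurable (scale_measure (of_nat CARD('n)) ?R)
      (restrict_space borel (sphere 0 1))"
  proof (rule measurable_restrict_space2)
    show "sgn \<in> space (scale_measure (of_nat CARD('n)) ?R) \<rightarrow> sphere 0 1"
      by (auto simp: space_scale_measure space_restrict_space norm_sgn)
    have "sgn \<in> borel_measurable ?R"
      unfolding sgn_div_norm by (intro measurable_restrict_space1) measurable
    then show "sgn \<in> borel_measurable (scale_measure (of_nat CARD('n)) ?R)" by simp
  qed
  have A: "A \<in> sets (restrict_space borel (sphere 0 1))"
    using assms by (auto simp: sets_restrict_space_iff)
  have eq: "sgn -` A \<inter> space ?R = {x \<in> ball 0 1 - {0}. sgn x \<in> A}"
    by (auto simp: space_restrict_space)
  have "emeasure sphere_measure A = of_nat CARD('n) * emeasure ?R (sgn -` A \<inter> space ?R)"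
    unfolding sphere_measure_def
    by (subst emeasure_distr[OF m A]) (simp add: space_scale_measure)
  also have "\<dots> = of_nat CARD('n) * emeasure lborel {x \<in> ball 0 1 - {0}. sgn x \<in> A}"
    unfolding eq by (subst emeasure_restrict_space) auto
  finally show ?thesis .
qed


section \<open>Collision integral\<close>

text \<open>
  Since \<open>sgn z = z / \<bar>z\<bar>\<close>, this is the kernel of separated form. At z = 0 the value is 0,
  which is irrelevant to the integrals.
\<close>

definition separated_kernel :: "real \<Rightarrow> (real \<Rightarrow> real) \<Rightarrow> real ^ 'n \<Rightarrow> real ^ 'n \<Rightarrow> real" where
  "separated_kernel \<beta> bhat z \<omega> = norm z powr \<beta> * bhat (\<omega> \<bullet> sgn z)"

definition collision_integrand ::
  "(real ^ 'n \<Rightarrow> real ^ 'n \<Rightarrow> real) \<Rightarrow> ('n::finite phase_time \<Rightarrow> real) \<Rightarrow> 'n::finite phase_time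
    \<Rightarrow> 'n::finite phase \<Rightarrow> real" where
  "collision_integrand b F = (\<lambda>(v, x, t) (\<omega>, w).
     (let v' = v - ((v - w) \<bullet> \<omega>) *\<^sub>R \<omega>;
          w' = w + ((v - w) \<bullet> \<omega>) *\<^sub>R \<omega>
      in (F (v', x, t) * F (w', x, t) - F (v, x, t) * F (w, x, t)) * b (v - w) \<omega>))"

definition collision ::
  "(real ^ 'n \<Rightarrow> real ^ 'n \<Rightarrow> real) \<Rightarrow> ('n::finite phase_time \<Rightarrow> real) \<Rightarrow> 'n::finite phase_time \<Rightarrow> real" where
  "collision b F z = (LINT p|(sphere_measure \<Otimes>\<^sub>M lborel). collision_integrand b F z p)"

definition attenuation ::
  "real \<Rightarrow> real \<Rightarrow> ('n::finite phase_time \<Rightarrow> real) \<Rightarrow> 'n::finite phase_time \<Rightarrow> real" where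
  "attenuation \<beta> bbar F = (\<lambda>(v, x, t).
     bbar * (LINT w|lborel. F (w, x, t) * norm (v - w) powr \<beta>))"


section \<open>Global Maxwellians\<close>

definition skew_symmetric :: "real ^ 'n ^ 'n \<Rightarrow> bool" where
  "skew_symmetric B \<longleftrightarrow> transpose B = - B"

definition positive_definite :: "real ^ 'n ^ 'n \<Rightarrow> bool" where
  "positive_definite A \<longleftrightarrow> transpose A = A \<and> (\<forall>y. y \<noteq> 0 \<longrightarrow> 0 < y \<bullet> (A *v y))"

definition maxwellian_Q :: "real \<Rightarrow> real \<Rightarrow> real \<Rightarrow> real ^ 'n ^ 'n \<Rightarrow> real ^ 'n ^ 'n" where
  "maxwellian_Q a b c B = (a * c - b\<^sup>2) *\<^sub>R mat 1 + B ** B"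

definition maxwellian_q ::
  "real \<Rightarrow> real \<Rightarrow> real \<Rightarrow> real ^ 'n ^ 'n \<Rightarrow> real ^ 'n \<Rightarrow> real ^ 'n \<Rightarrow> real \<Rightarrow> real" where
  "maxwellian_q a b c B v x t =
     (1/2) * (c * (norm v)\<^sup>2 + a * (norm (x - t *\<^sub>R v))\<^sup>2 + 2 * b * ((x - t *\<^sub>R v) \<bullet> v))
     - v \<bullet> (B *v (x - t *\<^sub>R v))"

text \<open>
  The centre in position moves with the mean velocity: the second argument of q is
  \<open>x - x0 - t v0\<close>, the Galilean boost of the Maxwellian centred at \<open>v0 = 0\<close>. It is this
  motion that makes the function a solution of the free transport equation (see
  \<open>maxwellian_transport\<close>) when \<open>v0\<close> is nonzero; with \<open>x - x0\<close> in its place, q would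
  depend on \<open>x - x0 - t (v - v0)\<close>, which free transport does not preserve.
\<close>

definition maxwellian ::
  "real \<Rightarrow> real \<Rightarrow> real \<Rightarrow> real \<Rightarrow> real ^ 'n ^ 'n \<Rightarrow> real ^ 'n \<Rightarrow> real ^ 'n
    \<Rightarrow> 'n::finite phase_time \<Rightarrow> real" where
  "maxwellian m a b c B v0 x0 = (\<lambda>(v, x, t).
     m / (2 * pi) ^ CARD('n) * sqrt (det (maxwellian_Q a b c B))
       * exp (- maxwellian_q a b c B (v - v0) (x - x0 - t *\<^sub>R v0) t))"

lemma maxwellian_transport:
  "maxwellian m a b c B v0 x0 (v, x + s *\<^sub>R v, t + s) = maxwellian m a b c B v0 x0 (v, x, t)"
proof -
  have "x + s *\<^sub>R v - x0 - (t + s) *\<^sub>R v0 - (t + s) *\<^sub>R (v - v0)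
      = x - x0 - t *\<^sub>R v0 - t *\<^sub>R (v - v0)"
    by (simp add: algebra_simps)
  then show ?thesis
    by (simp only: maxwellian_def maxwellian_q_def split_conv)
qed

definition global_maxwellian :: "('n::finite phase_time \<Rightarrow> real) \<Rightarrow> bool" where
  "global_maxwellian M \<longleftrightarrow>
     (\<exists>m a b c B v0 x0. 0 < m \<and> 0 < a \<and> 0 < c \<and> skew_symmetric B \<and>
        positive_definite (maxwellian_Q a b c B) \<and> M = maxwellian m a b c B v0 x0)"

text \<open>
  Used for nonnegative M only, so the time integral is that of a nonnegative function; it and
  the supremum are taken in \<open>[0, \<infinity>]\<close>.
\<close>

definition nu :: "real \<Rightarrow> real \<Rightarrow> ('n::finite phase_time \<Rightarrow> real) \<Rightarrow> ennreal" where
  "nu \<beta> bbar M =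
     (SUP (v, x, t)\<in>UNIV.
        \<integral>\<^sup>+ s. ennreal (attenuation \<beta> bbar M (v, x - t *\<^sub>R v + s *\<^sub>R v, s)) \<partial>lborel)"


section \<open>Weighted spaces\<close>

definition weighted_Linf :: "('a::euclidean_space \<Rightarrow> real) \<Rightarrow> ('a \<Rightarrow> real) set" where
  "weighted_Linf W =
     {f \<in> borel_measurable lborel. esssup lborel (\<lambda>z. ereal \<bar>f z / W z\<bar>) < \<infinity>}"

definition weighted_norm :: "('a::euclidean_space \<Rightarrow> real) \<Rightarrow> ('a \<Rightarrow> real) \<Rightarrow> real" where
  "weighted_norm W f = real_of_ereal (esssup lborel (\<lambda>z. ereal \<bar>f z / W z\<bar>))"

definition at_time :: "('n::finite phase_time \<Rightarrow> real) \<Rightarrow> real \<Rightarrow> 'n::finite phase \<Rightarrow> real" where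
  "at_time F t = (\<lambda>(v, x). F (v, x, t))"


section \<open>Mild solutions\<close>

definition free_flow :: "real \<Rightarrow> ('n::finite phase \<Rightarrow> real) \<Rightarrow> 'n::finite phase \<Rightarrow> real" where
  "free_flow t \<phi> = (\<lambda>(v, x). \<phi> (v, x + t *\<^sub>R v))"

definition locally_integrable_on :: "('a::euclidean_space \<Rightarrow> real) \<Rightarrow> 'a set \<Rightarrow> bool" where
  "locally_integrable_on f S \<longleftrightarrow> (\<forall>K. compact K \<and> K \<subseteq> S \<longrightarrow> set_integrable lborel K f)"

text \<open>
  The integrability of the collision integrand says that \<open>collision b F\<close> is a genuine
  integral almost everywhere rather than the default value 0 of a divergent one. As the
  identity holds for almost every (v,x) simultaneously for all times, F is
  the representative that is continuous in time with values in L-1-loc, so that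
  \<open>at_time F t\<close> is well defined up to null sets for every t in I.
\<close>

definition mild_solution ::
  "(real ^ 'n \<Rightarrow> real ^ 'n \<Rightarrow> real) \<Rightarrow> real set \<Rightarrow> ('n::finite phase_time \<Rightarrow> real) \<Rightarrow> bool" where
  "mild_solution b I F \<longleftrightarrow>
     locally_integrable_on F (UNIV \<times> UNIV \<times> I) \<and>
     (AE (v, x, t) in lborel. t \<in> I \<longrightarrow>
        integrable (sphere_measure \<Otimes>\<^sub>M lborel) (collision_integrand b F (v, x, t))) \<and>
     locally_integrable_on (collision b F) (UNIV \<times> UNIV \<times> I) \<and>
     (AE p in lborel. \<forall>t1\<in>I. \<forall>t2\<in>I.
        free_flow t2 (at_time F t2) p =
        free_flow t1 (at_time F t1) p +
        (LBINT s=t1..t2. free_flow s (at_time (collision b F) s) p))"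

definition solution_near ::
  "(real ^ 'n \<Rightarrow> real ^ 'n \<Rightarrow> real) \<Rightarrow> ('n::finite phase_time \<Rightarrow> real) \<Rightarrow> ('n::finite phase \<Rightarrow> real) \<Rightarrow> real
    \<Rightarrow> ('n::finite phase_time \<Rightarrow> real) \<Rightarrow> bool" where
  "solution_near b M Fin r F \<longleftrightarrow>
     F \<in> weighted_Linf M \<and>
     mild_solution b UNIV F \<and>
     (AE p in lborel. at_time F 0 p = Fin p) \<and>
     weighted_norm M (\<lambda>z. F z - M z) \<le> r"

end

theory Submission
  imports Defs
begin

text \<open>
  Conservation of the quadratic exponent in collisions turns \<open>M(v') M(v'\<^sub>*)\<close> into \<open>M(v) M(v\<^sub>*)\<close>, so
  \<open>\<bar>B(F,F) - B(G,G)\<bar> \<le> 2 (p + q) k M A(M)\<close> whenever \<open>\<bar>F\<bar> \<le> p M\<close>, \<open>\<bar>G\<bar> \<le> q M\<close> and \<open>\<bar>F - G\<bar> \<le> k M\<close>.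
  As \<open>M\<close> is constant along free transport, integrating in time costs a factor \<open>\<nu>\<close>. With \<open>G = M\<close>, where the
  collision integral vanishes, this shows that the Duhamel map preserves the ball of radius \<open>r\<close> around \<open>M\<close>
  in the weighted norm when \<open>\<delta> + 2 (2 + r) r \<nu> \<le> r\<close>, and \<open>r\<close> is the smaller root of the corresponding
  quadratic equation. On that ball the map is a contraction with constant \<open>4 (1 + r) \<nu> < 1\<close>.
\<close>

subsection \<open>Orthogonal invariance of the surface measure\<close>

text \<open>Two difficulties shape the proof. The loss term at \<open>M\<close> is
  \<open>attenuation\<close> only if the angular integral of \<open>bhat\<close> is the same for
  every direction \<open>sgn (v - w)\<close>, whereas \<open>bbar\<close> is computed at one unit
  vector; this calls for orthogonal invariance of \<open>sphere_measure\<close>. The other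
  difficulty is null sets: the collision integral samples F at v', w', v and w with (x, t) fixed, so
  an almost everywhere bound on F does not control it at once. Existence avoids this by iterating
  Borel functions that are bounded at every point, so that the limit solves the integral equation
  along every characteristic. Uniqueness has to start from almost everywhere data and rests on the
  fact that changing F on a null set changes its collision integral only on a null set. The factor 2
  in the basic estimate counts gain and loss, which obey the same bound. Since \<open>nu\<close>
  integrates over the whole time axis, the contraction is global in time and no short interval is
  needed.\<close>

lemma nn_integral_lborel_translate:
  fixes f :: "'a::euclidean_space \<Rightarrow> ennreal"
  assumes [measurable]: "f \<in> borel_measurable borel"
  shows "(\<integral>\<^sup>+x. f (a + x) \<partial>lborel) = (\<integral>\<^sup>+x. f x \<partial>lborel)"
  by (subst (2) lborel_distr_plus[of a, symmetric]) (simp add: nn_integral_distr)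

lemma nn_integral_lborel_reflect:
  fixes f :: "'a::euclidean_space \<Rightarrow> ennreal"
  assumes [measurable]: "f \<in> borel_measurable borel"
  shows "(\<integral>\<^sup>+x. f (a - x) \<partial>lborel) = (\<integral>\<^sup>+x. f x \<partial>lborel)"
  by (subst (2) lborel_affine[of "-1" a]) (simp_all add: nn_integral_density nn_integral_distr)

lemma AE_lborel_translate:
  fixes a :: "'a::euclidean_space"
  assumes "AE x in lborel. P x"
  shows "AE x in lborel. P (a + x)"
proof -
  have "AE x in distr lborel borel ((+) a). P x"
    using assms lborel_distr_plus[of a] by metis
  then show ?thesis
    by (rule AE_distrD[rotated]) simp
qed

text \<open>Uniqueness of Haar measure by Fubini: both orders of integration of
  \<open>1\<^sub>A (f x) * 1\<^sub>B (y + f x)\<close> are evaluated by translation invariance, with the unit ball as \<open>B\<close>.\<close>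

lemma distr_lborel_orthogonal:
  fixes f :: "'a::euclidean_space \<Rightarrow> 'a"
  assumes f: "orthogonal_transformation f"
  shows "distr lborel borel f = lborel"
proof (rule measure_eqI)
  fix A :: "'a set" assume "A \<in> sets (distr lborel borel f)"
  then have A[measurable]: "A \<in> sets borel" by simp
  have lin: "linear f" using f by (rule orthogonal_transformation_linear)
  have fm[measurable]: "f \<in> borel_measurable borel"
    by (intro borel_measurable_continuous_onI linear_continuous_on linear_conv_bounded_linear[THEN iffD1] lin)
  have inv_f: "f (inv f y) = y" for y
    using orthogonal_transformation_surj[OF f] by (simp add: surj_f_inv_f)
  define B where "B = ball (0::'a) 1"
  have B[measurable]: "B \<in> sets borel" by (simp add: B_def)
  have fB: "f x \<in> B \<longleftrightarrow> x \<in> B" for x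
    using orthogonal_transformation_norm[OF f, of x] by (simp add: B_def)
  let ?A = "\<lambda>x. indicator A x :: ennreal" and ?B = "\<lambda>x. indicator B x :: ennreal"
  have "emeasure (distr lborel borel f) A * emeasure lborel B
      = (\<integral>\<^sup>+x. ?A (f x) \<partial>lborel) * (\<integral>\<^sup>+y. ?B y \<partial>lborel)"
    by (simp add: nn_integral_distr flip: nn_integral_indicator)
  also have "\<dots> = (\<integral>\<^sup>+x. \<integral>\<^sup>+y. ?A (f x) * ?B (f x + y) \<partial>lborel \<partial>lborel)"
    by (simp add: nn_integral_cmult nn_integral_multc nn_integral_lborel_translate[of ?B])
  also have "\<dots> = (\<integral>\<^sup>+y. \<integral>\<^sup>+x. ?A (f x) * ?B (f x + y) \<partial>lborel \<partial>lborel)"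
    by (rule lborel_pair.Fubini') measurable
  also have "\<dots> = (\<integral>\<^sup>+y. \<integral>\<^sup>+x. ?A (f x - y) * ?B (f x) \<partial>lborel \<partial>lborel)"
  proof (rule nn_integral_cong)
    fix y
    have "f (- inv f y + x) = f x - y" for x
      using linear_add[OF lin, of "- inv f y" x] linear_neg[OF lin, of "inv f y"] inv_f[of y] by simp
    then show "(\<integral>\<^sup>+x. ?A (f x) * ?B (f x + y) \<partial>lborel) = (\<integral>\<^sup>+x. ?A (f x - y) * ?B (f x) \<partial>lborel)"
      by (subst nn_integral_lborel_translate[of _ "- inv f y", symmetric]) simp_all
  qed
  also have "\<dots> = (\<integral>\<^sup>+x. \<integral>\<^sup>+y. ?A (f x - y) * ?B (f x) \<partial>lborel \<partial>lborel)"
    by (rule lborel_pair.Fubini') measurable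
  also have "\<dots> = (\<integral>\<^sup>+x. (\<integral>\<^sup>+y. ?A y \<partial>lborel) * ?B x \<partial>lborel)"
    by (simp add: nn_integral_multc nn_integral_lborel_reflect[of ?A] fB indicator_def[of B])
  also have "\<dots> = emeasure lborel A * emeasure lborel B"
    by (subst nn_integral_cmult) auto
  finally have "emeasure (distr lborel borel f) A * emeasure lborel B = emeasure lborel A * emeasure lborel B" .
  moreover have "emeasure lborel B \<noteq> 0" "emeasure lborel B \<noteq> \<infinity>"
    using unit_ball_vol_pos[of "real DIM('a)"] by (auto simp: B_def emeasure_ball simp del: unit_ball_vol_pos)
  ultimately show "emeasure (distr lborel borel f) A = emeasure lborel A"
    by (simp add: mult.commute[of _ "emeasure lborel B"] ennreal_mult_cancel_left)
qed simp

lemma space_sphere_measure [simp]: "space (sphere_measure :: (real ^ 'n) measure) = sphere 0 1"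
  by (simp add: sphere_measure_def space_restrict_space)

lemma sets_sphere_measure [measurable_cong]:
  "sets (sphere_measure :: (real ^ 'n) measure) = sets (restrict_space borel (sphere 0 1))"
  by (simp add: sphere_measure_def)

lemma finite_measure_sphere_measure: "finite_measure (sphere_measure :: (real ^ 'n) measure)"
proof
  have "emeasure (sphere_measure :: (real ^ 'n) measure) (sphere 0 1)
      = of_nat CARD('n) * emeasure lborel {x \<in> ball 0 1 - {0 :: real ^ 'n}. sgn x \<in> sphere 0 1}"
    by (rule emeasure_sphere_measure) auto
  also have "\<dots> \<le> of_nat CARD('n) * emeasure lborel (ball (0 :: real ^ 'n) 1)"
    by (intro mult_left_mono emeasure_mono) auto
  also have "\<dots> < \<infinity>"
    using emeasure_lborel_ball_finite[of "0 :: real ^ 'n" 1]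
    by (auto simp: ennreal_mult_less_top of_nat_less_top)
  finally show "emeasure (sphere_measure :: (real ^ 'n) measure) (space sphere_measure) \<noteq> \<infinity>"
    by simp
qed

interpretation sphere_measure: finite_measure "sphere_measure :: (real ^ 'n) measure"
  by (rule finite_measure_sphere_measure)

interpretation sphere_lborel: pair_sigma_finite "sphere_measure :: (real ^ 'n) measure" "lborel :: 'a::euclidean_space measure" ..

text \<open>\<open>f\<close> preserves the norm and commutes with \<open>sgn\<close>, so the cone
  over the preimage of \<open>A\<close> is the preimage of the cone over \<open>A\<close>;
  invariance of Lebesgue measure does the rest.\<close>

lemma sphere_measure_orthogonal:
  fixes f :: "real ^ 'n \<Rightarrow> real ^ 'n"
  assumes f: "orthogonal_transformation f"
  shows "distr sphere_measure sphere_measure f = sphere_measure"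
proof (rule measure_eqI)
  have lin: "linear f" using f by (rule orthogonal_transformation_linear)
  have fm[measurable]: "f \<in> borel_measurable borel"
    by (intro borel_measurable_continuous_onI linear_continuous_on linear_conv_bounded_linear[THEN iffD1] lin)
  have norm_f: "norm (f x) = norm x" for x
    using orthogonal_transformation_norm[OF f] .
  have fs: "f \<in> sphere_measure \<rightarrow>\<^sub>M sphere_measure"
    unfolding measurable_cong_sets[OF sets_sphere_measure sets_sphere_measure]
    by (intro measurable_restrict_space3) (auto simp: norm_f)
  fix A assume "A \<in> sets (distr sphere_measure sphere_measure f)"
  then have A: "A \<in> sets sphere_measure" by simp
  then have A'[measurable]: "A \<in> sets borel" and As: "A \<subseteq> sphere 0 1"
    by (auto simp: sets_sphere_measure sets_restrict_space_iff)
  have sub: "f -` A \<subseteq> sphere 0 1" using As norm_f by force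
  have m: "f -` A \<in> sets borel" using measurable_sets[OF fm A'] by simp
  let ?S = "{x \<in> ball 0 1 - {0}. sgn x \<in> A}"
  have S: "?S \<in> sets borel" by (simp add: sgn_div_norm) measurable
  have "emeasure (distr sphere_measure sphere_measure f) A = emeasure sphere_measure (f -` A)"
    using sub by (simp add: emeasure_distr[OF fs A] Int_absorb2)
  also have "\<dots> = of_nat CARD('n) * emeasure lborel {x \<in> ball 0 1 - {0}. sgn x \<in> f -` A}"
    by (rule emeasure_sphere_measure[OF m sub])
  also have "{x \<in> ball 0 1 - {0}. sgn x \<in> f -` A} = f -` ?S"
    using norm_f norm_eq_zero by (auto simp: sgn_div_norm linear_scale[OF lin]) (metis norm_eq_zero)+
  also have "emeasure lborel (f -` ?S) = emeasure (distr lborel borel f) ?S"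
    by (subst emeasure_distr) (use S in auto)
  also have "\<dots> = emeasure lborel ?S"
    by (simp add: distr_lborel_orthogonal[OF f])
  finally show "emeasure (distr sphere_measure sphere_measure f) A = emeasure sphere_measure A"
    by (simp add: emeasure_sphere_measure[OF A' As])
qed simp

text \<open>An orthogonal map taking \<open>n\<close> to \<open>e\<close> carries one integral into
  the other. This is why \<open>bbar\<close>, computed at a single unit vector, serves every
  relative velocity.\<close>

lemma nn_integral_sphere_measure_unit_indep:
  fixes n e :: "real ^ 'n" and h :: "real \<Rightarrow> ennreal"
  assumes [measurable]: "h \<in> borel_measurable borel" and "norm n = 1" "norm e = 1"
  shows "(\<integral>\<^sup>+\<omega>. h (\<omega> \<bullet> e) \<partial>sphere_measure) = (\<integral>\<^sup>+\<omega>. h (\<omega> \<bullet> n) \<partial>sphere_measure)"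
proof -
  obtain f where f: "orthogonal_transformation f" "f n = e"
    using orthogonal_transformation_exists_1 assms by metis
  have lin: "linear f" using f(1) by (rule orthogonal_transformation_linear)
  have [measurable]: "f \<in> borel_measurable borel"
    by (intro borel_measurable_continuous_onI linear_continuous_on linear_conv_bounded_linear[THEN iffD1] lin)
  have fs[measurable]: "f \<in> sphere_measure \<rightarrow>\<^sub>M sphere_measure"
    unfolding measurable_cong_sets[OF sets_sphere_measure sets_sphere_measure]
    using orthogonal_transformation_norm[OF f(1)]
    by (intro measurable_restrict_space3) auto
  have [measurable]: "(\<lambda>\<omega>. h (\<omega> \<bullet> e)) \<in> borel_measurable sphere_measure"
    unfolding measurable_cong_sets[OF sets_sphere_measure refl] by (intro measurable_restrict_space1) measurable
  have "(\<integral>\<^sup>+\<omega>. h (\<omega> \<bullet> e) \<partial>sphere_measure) = (\<integral>\<^sup>+\<omega>. h (f \<omega> \<bullet> e) \<partial>sphere_measure)"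
    by (subst sphere_measure_orthogonal[OF f(1), symmetric]) (simp add: nn_integral_distr)
  then show ?thesis
    using f(1)[unfolded orthogonal_transformation_def, THEN conjunct2, rule_format, of _ n] f(2) by simp
qed

subsection \<open>Moments of Gaussians and global Maxwellians\<close>

text \<open>Each half-line contributes at most \<open>Gamma (\<gamma> + 1)\<close>, which is where
  \<open>- 1 < \<gamma>\<close> enters.\<close>

lemma nn_integral_abs_powr_exp_finite:
  fixes \<gamma> :: real
  assumes "- 1 < \<gamma>"
  shows "(\<integral>\<^sup>+s. ennreal (\<bar>s\<bar> powr \<gamma> * exp (- \<bar>s\<bar>)) \<partial>lborel) < \<infinity>"
proof -
  define g :: "real \<Rightarrow> ennreal" where "g t = ennreal (indicator {0..} t * t powr \<gamma> / exp t)" for t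
  have [measurable]: "g \<in> borel_measurable borel" unfolding g_def by measurable
  have g: "(\<integral>\<^sup>+s. g s \<partial>lborel) = ennreal (Gamma (\<gamma> + 1))"
    using Gamma_conv_nn_integral_real[of "\<gamma> + 1"] assms by (simp add: g_def)
  have "(\<integral>\<^sup>+s. ennreal (\<bar>s\<bar> powr \<gamma> * exp (- \<bar>s\<bar>)) \<partial>lborel) \<le> (\<integral>\<^sup>+s. g s + g (0 - s) \<partial>lborel)"
    by (intro nn_integral_mono)
      (auto simp: g_def indicator_def exp_minus field_simps simp flip: ennreal_plus split: if_splits)
  also have "\<dots> = ennreal (Gamma (\<gamma> + 1)) + ennreal (Gamma (\<gamma> + 1))"
    by (subst nn_integral_add) (simp_all add: nn_integral_lborel_reflect[of g 0, simplified] g)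
  also have "\<dots> < \<infinity>" by (simp add: less_top[symmetric])
  finally show ?thesis .
qed

text \<open>For \<open>\<beta> < 0\<close> the singularity is integrable because \<open>\<bar>u\<bar> \<ge> \<bar>u\<^sub>i\<bar>\<close> dominates \<open>\<bar>u\<bar>\<^sup>\<beta>\<close> by the
  product of the one-dimensional powers \<open>\<bar>u\<^sub>i\<bar>\<close> to the exponent \<open>\<beta> / D > -1\<close>.\<close>

lemma nn_integral_norm_powr_exp_finite:
  fixes \<beta> :: real
  assumes \<beta>: "- real DIM('a::euclidean_space) < \<beta>" "\<beta> \<le> 0"
  shows "(\<integral>\<^sup>+u. ennreal (norm u powr \<beta> * exp (- (\<Sum>i\<in>Basis. \<bar>u \<bullet> i\<bar>))) \<partial>(lborel :: 'a measure)) < \<infinity>"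
proof -
  define \<gamma> where "\<gamma> = \<beta> / real DIM('a)"
  have \<gamma>: "- 1 < \<gamma>" "\<gamma> \<le> 0" "\<beta> = (\<Sum>i\<in>(Basis :: 'a set). \<gamma>)"
    using \<beta> DIM_positive[where 'a='a] by (auto simp: \<gamma>_def field_simps divide_nonpos_pos)
  have ae: "AE u in (lborel :: 'a measure). \<forall>i\<in>Basis. u \<bullet> i \<noteq> 0"
    by (intro AE_finite_allI AE_lborel_inner_neq) auto
  have "(\<integral>\<^sup>+u. ennreal (norm u powr \<beta> * exp (- (\<Sum>i\<in>Basis. \<bar>u \<bullet> i\<bar>))) \<partial>(lborel :: 'a measure))
      \<le> (\<integral>\<^sup>+u. (\<Prod>i\<in>Basis. ennreal (\<bar>u \<bullet> i\<bar> powr \<gamma> * exp (- \<bar>u \<bullet> i\<bar>))) \<partial>(lborel :: 'a measure))"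
  proof (rule nn_integral_mono_AE, use ae in eventually_elim)
    case (elim u)
    note u = this
    then have "u \<noteq> 0" using nonempty_Basis by fastforce
    have "norm u powr \<beta> = (\<Prod>i\<in>(Basis :: 'a set). norm u powr \<gamma>)"
      unfolding \<gamma>(3) using \<open>u \<noteq> 0\<close> by (intro powr_sum) auto
    also have "\<dots> \<le> (\<Prod>i\<in>Basis. \<bar>u \<bullet> i\<bar> powr \<gamma>)"
      using u \<gamma>(2) by (intro prod_mono conjI powr_mono2' Basis_le_norm) auto
    finally have "norm u powr \<beta> * exp (- (\<Sum>i\<in>Basis. \<bar>u \<bullet> i\<bar>))
        \<le> (\<Prod>i\<in>Basis. \<bar>u \<bullet> i\<bar> powr \<gamma>) * exp (- (\<Sum>i\<in>Basis. \<bar>u \<bullet> i\<bar>))"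
      by (intro mult_right_mono) auto
    also have "\<dots> = (\<Prod>i\<in>Basis. \<bar>u \<bullet> i\<bar> powr \<gamma> * exp (- \<bar>u \<bullet> i\<bar>))"
      by (simp add: prod.distrib exp_sum flip: sum_negf)
    finally show ?case
      by (simp add: prod_ennreal ennreal_leI)
  qed
  also have "\<dots> = (\<Prod>i\<in>(Basis :: 'a set). \<integral>\<^sup>+s. ennreal (\<bar>s\<bar> powr \<gamma> * exp (- \<bar>s\<bar>)) \<partial>lborel)"
    by (rule nn_integral_lborel_prod[of "\<lambda>_ s. ennreal (\<bar>s\<bar> powr \<gamma> * exp (- \<bar>s\<bar>))"]) auto
  also have "\<dots> < \<infinity>"
    using nn_integral_abs_powr_exp_finite[OF \<gamma>(1)] by (simp add: power_less_top_ennreal)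
  finally show ?thesis .
qed

text \<open>With \<open>w = v + u\<close>, the exponent splits as
  \<open>\<beta> = \<beta>0 + K\<close>: the negative part keeps the integrable singularity, the
  positive part grows at most like \<open>exp (K * norm u)\<close>. Completing the square lets the
  Gaussian absorb an exponential of slope \<open>L\<close>, which collects the linear term, this
  growth and the decay of the weight \<open>?E\<close>. The second term in \<open>C\<close> pays for
  the Gaussian being centred at \<open>a\<close> instead of \<open>v\<close>.\<close>

lemma integrable_gaussian_norm_powr:
  fixes v a l :: "'a::euclidean_space"
  assumes \<sigma>: "0 < \<sigma>" and \<beta>: "- real DIM('a) < \<beta>"
  shows "integrable lborel (\<lambda>w. exp (- (\<sigma> / 2 * (norm (w - a))\<^sup>2 + (w - a) \<bullet> l)) * norm (v - w) powr \<beta>)"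
proof (rule integrableI_bounded)
  define \<beta>0 K L C where "\<beta>0 = min \<beta> 0" and "K = max \<beta> 0" and "L = norm l + K + real DIM('a)"
    and "C = exp (L\<^sup>2 / (2 * \<sigma>) + (K + real DIM('a)) * norm (v - a))"
  let ?f = "\<lambda>w. exp (- (\<sigma> / 2 * (norm (w - a))\<^sup>2 + (w - a) \<bullet> l)) * norm (v - w) powr \<beta>"
  let ?E = "\<lambda>u::'a. exp (- (\<Sum>i\<in>Basis. \<bar>u \<bullet> i\<bar>))"
  have bound: "?f (v + u) \<le> C * (norm u powr \<beta>0 * ?E u)" for u
  proof (cases "u = 0")
    \<comment> \<open>In the remaining case \<open>u = 0\<close> both sides vanish, because a power
      of 0 is 0 for every exponent.\<close>
    case False
    define s where "s = norm (v + u - a)"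
    have "K \<ge> 0" by (simp add: K_def)
    have us: "norm u \<le> s + norm (v - a)"
      unfolding s_def using norm_triangle_ineq4[of "v + u - a" "v - a"] by simp
    have "norm u powr \<beta> = norm u powr \<beta>0 * norm u powr K"
      using False by (simp add: \<beta>0_def K_def min_def max_def flip: powr_add)
    also have "norm u powr K \<le> exp (K * norm u)"
      using False \<open>K \<ge> 0\<close> ln_less_self[of "norm u"] by (simp add: powr_def mult_left_mono less_imp_le)
    finally have p: "norm u powr \<beta> \<le> norm u powr \<beta>0 * exp (K * norm u)" by (simp add: mult_left_mono)
    have "(\<Sum>i\<in>Basis. \<bar>u \<bullet> i\<bar>) \<le> real DIM('a) * norm u"
      using sum_bounded_above[of Basis "\<lambda>i. \<bar>u \<bullet> i\<bar>" "norm u"] Basis_le_norm by fastforce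
    moreover have "- ((v + u - a) \<bullet> l) \<le> s * norm l"
      unfolding s_def using Cauchy_Schwarz_ineq2[of "v + u - a" l] by linarith
    moreover have "(K + real DIM('a)) * norm u \<le> (K + real DIM('a)) * (s + norm (v - a))"
      using us \<open>K \<ge> 0\<close> by (intro mult_left_mono) auto
    moreover have "L * s - \<sigma> / 2 * s\<^sup>2 \<le> L\<^sup>2 / (2 * \<sigma>)"
    proof -
      have "0 \<le> (\<sigma> * s - L)\<^sup>2 / (2 * \<sigma>)" using \<sigma> by simp
      also have "\<dots> = L\<^sup>2 / (2 * \<sigma>) - (L * s - \<sigma> / 2 * s\<^sup>2)"
        using \<sigma> by (simp add: field_simps power2_eq_square)
      finally show ?thesis by simp
    qed
    ultimately have "- (\<sigma> / 2 * s\<^sup>2 + (v + u - a) \<bullet> l) + K * norm u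
        \<le> L\<^sup>2 / (2 * \<sigma>) + (K + real DIM('a)) * norm (v - a) - (\<Sum>i\<in>Basis. \<bar>u \<bullet> i\<bar>)"
      by (simp add: L_def algebra_simps)
    then have e: "exp (- (\<sigma> / 2 * s\<^sup>2 + (v + u - a) \<bullet> l)) * exp (K * norm u) \<le> C * ?E u"
      unfolding C_def by (simp flip: exp_add)
    have "?f (v + u) \<le> exp (- (\<sigma> / 2 * s\<^sup>2 + (v + u - a) \<bullet> l)) * (norm u powr \<beta>0 * exp (K * norm u))"
      using p by (simp add: s_def)
    also have "\<dots> = norm u powr \<beta>0 * (exp (- (\<sigma> / 2 * s\<^sup>2 + (v + u - a) \<bullet> l)) * exp (K * norm u))"
      by (simp only: ac_simps)
    also have "\<dots> \<le> norm u powr \<beta>0 * (C * ?E u)"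
      by (intro mult_left_mono e) auto
    finally show ?thesis by (simp only: ac_simps)
  qed (simp add: C_def)
  have "(\<integral>\<^sup>+w. ennreal (norm (?f w)) \<partial>lborel) = (\<integral>\<^sup>+u. ennreal (?f (v + u)) \<partial>lborel)"
    by (subst nn_integral_lborel_translate[of _ v, symmetric]) auto
  also have "\<dots> \<le> (\<integral>\<^sup>+u. ennreal C * ennreal (norm u powr \<beta>0 * ?E u) \<partial>lborel)"
    by (intro nn_integral_mono, subst ennreal_mult[symmetric]) (use bound in \<open>auto simp: C_def intro!: ennreal_leI\<close>)
  also have "\<dots> = ennreal C * (\<integral>\<^sup>+u. ennreal (norm u powr \<beta>0 * ?E u) \<partial>lborel)"
    by (rule nn_integral_cmult) simp
  also have "\<dots> < \<infinity>"
    using nn_integral_norm_powr_exp_finite[where 'a='a and \<beta>=\<beta>0] \<beta>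
    by (auto simp: \<beta>0_def ennreal_mult_less_top)
  finally show "(\<integral>\<^sup>+w. ennreal (norm (?f w)) \<partial>lborel) < \<infinity>" .
qed simp

section \<open>The exponent of a Maxwellian as a function of velocity\<close>

lemma skew_symmetric_inner:
  assumes "skew_symmetric B"
  shows "y \<bullet> (B *v z) = - ((B *v y) \<bullet> z)"
proof -
  have "(transpose B *v y) \<bullet> z = y \<bullet> (B *v z)"
    by (simp only: transpose_matrix_vector dot_lmul_matrix)
  moreover have "(- B) *v y = - (B *v y)"
    by (simp add: vec_eq_iff matrix_vector_mult_def sum_negf)
  ultimately show ?thesis
    using assms by (simp only: skew_symmetric_def inner_minus_left)
qed

text \<open>Skew-symmetry kills \<open>u \<bullet> (B *v u)\<close>, so \<open>B\<close> enters only
  the linear term and the quadratic part in \<open>u\<close> is a multiple of the squared norm. This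
  isotropy is what collisions conserve.\<close>

lemma maxwellian_q_quadratic:
  assumes "skew_symmetric B"
  shows "maxwellian_q a b c B u X t = (c - 2 * b * t + a * t\<^sup>2) / 2 * (norm u)\<^sup>2
    + u \<bullet> ((b - a * t) *\<^sub>R X - B *v X) + a / 2 * (norm X)\<^sup>2"
proof -
  have "u \<bullet> (B *v u) = - (u \<bullet> (B *v u))"
    using skew_symmetric_inner[OF assms, of u u] by (simp add: inner_commute)
  then have skew: "u \<bullet> (B *v u) = 0" by simp
  have "(norm (X - t *\<^sub>R u))\<^sup>2 = (norm X)\<^sup>2 - 2 * t * (u \<bullet> X) + t\<^sup>2 * (norm u)\<^sup>2"
    unfolding power2_norm_eq_inner by (simp add: inner_diff inner_commute power2_eq_square algebra_simps)
  moreover have "(X - t *\<^sub>R u) \<bullet> u = u \<bullet> X - t * (norm u)\<^sup>2"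
    by (simp add: inner_diff inner_commute power2_norm_eq_inner)
  moreover have "u \<bullet> (B *v (X - t *\<^sub>R u)) = u \<bullet> (B *v X)"
    by (simp add: matrix_vector_mult_diff_distrib inner_diff_right matrix_vector_mult_scaleR skew)
  ultimately show ?thesis
    unfolding maxwellian_q_def
    by (simp only: inner_diff_right inner_scaleR_right) (simp add: field_simps power2_eq_square)
qed

text \<open>Testing \<open>maxwellian_Q\<close> on a unit vector \<open>y\<close> gives
  \<open>b\<^sup>2 < a * c\<close>, because \<open>B ** B\<close> contributes minus the squared norm
  of \<open>B *v y\<close>. The polynomial in \<open>t\<close> therefore has negative
  discriminant.\<close>

lemma maxwellian_variance_pos:
  fixes B :: "real ^ 'n ^ 'n"
  assumes "0 < a" "skew_symmetric B" "positive_definite (maxwellian_Q a b c B)"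
  shows "0 < c - 2 * b * t + a * t\<^sup>2"
proof -
  obtain y :: "real ^ 'n" where y: "norm y = 1" using vector_choose_size[of 1] by auto
  then have "y \<noteq> 0" by auto
  then have "0 < y \<bullet> (maxwellian_Q a b c B *v y)"
    using assms(3) unfolding positive_definite_def by blast
  also have "\<dots> = (a * c - b\<^sup>2) + y \<bullet> (B *v (B *v y))"
    using y by (simp add: maxwellian_Q_def matrix_vector_mult_add_rdistrib inner_add_right
        scaleR_matrix_vector_assoc[symmetric] matrix_vector_mul_assoc flip: power2_norm_eq_inner)
  also have "y \<bullet> (B *v (B *v y)) = - ((B *v y) \<bullet> (B *v y))"
    by (rule skew_symmetric_inner[OF assms(2)])
  finally have "b\<^sup>2 < a * c" using inner_ge_zero[of "B *v y"] by linarith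
  then have "0 < (a * c - b\<^sup>2) + (a * t - b)\<^sup>2" by (simp add: add_pos_nonneg)
  also have "\<dots> = a * (c - 2 * b * t + a * t\<^sup>2)" by (simp add: power2_eq_square algebra_simps)
  finally show ?thesis using assms(1) by (simp add: zero_less_mult_iff)
qed

text \<open>With position and time frozen, an isotropic Gaussian in \<open>v\<close> with a linear
  term remains. Both the collision balance and the velocity moments are read off from this
  form.\<close>

lemma maxwellian_gaussian:
  fixes B :: "real ^ 'n ^ 'n"
  assumes "0 < a" "skew_symmetric B" "positive_definite (maxwellian_Q a b c B)"
  shows "\<exists>\<sigma> l k. 0 < \<sigma> \<and> (\<forall>v. maxwellian m a b c B v0 x0 (v, x, t) =
    m / (2 * pi) ^ CARD('n) * sqrt (det (maxwellian_Q a b c B))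
      * (exp (- k) * exp (- (\<sigma> / 2 * (norm (v - v0))\<^sup>2 + (v - v0) \<bullet> l))))"
proof -
  define X where "X = x - x0 - t *\<^sub>R v0"
  show ?thesis
    by (intro exI[of _ "c - 2 * b * t + a * t\<^sup>2"] exI[of _ "(b - a * t) *\<^sub>R X - B *v X"]
        exI[of _ "a / 2 * (norm X)\<^sup>2"] conjI maxwellian_variance_pos[OF assms])
      (simp add: maxwellian_def maxwellian_q_quadratic[OF assms(2)] flip: X_def exp_add)
qed

lemma continuous_on_maxwellian: "continuous_on UNIV (maxwellian m a b c B v0 x0)"
  unfolding maxwellian_def maxwellian_q_def split_beta'
  by (intro continuous_intros linear_continuous_on_compose[OF _ matrix_vector_mul_linear])

subsection \<open>Free transport and null sets\<close>

lemma nn_integral_lborel_pair: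
  fixes f :: "'a::euclidean_space \<times> 'b::euclidean_space \<Rightarrow> ennreal"
  assumes "f \<in> borel_measurable borel"
  shows "(\<integral>\<^sup>+z. f z \<partial>lborel) = (\<integral>\<^sup>+x. \<integral>\<^sup>+y. f (x, y) \<partial>lborel \<partial>lborel)"
  by (subst lborel.nn_integral_fst) (simp_all add: lborel_prod assms)

lemma nn_integral_lborel_swap:
  fixes f :: "'a::euclidean_space \<Rightarrow> 'b::euclidean_space \<Rightarrow> ennreal"
  assumes "(\<lambda>z. f (fst z) (snd z)) \<in> borel_measurable borel"
  shows "(\<integral>\<^sup>+x. \<integral>\<^sup>+y. f x y \<partial>lborel \<partial>lborel) = (\<integral>\<^sup>+y. \<integral>\<^sup>+x. f x y \<partial>lborel \<partial>lborel)"
  using lborel_pair.Fubini[of "\<lambda>z. f (fst z) (snd z)"] assms by (simp add: lborel_prod)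

lemma measurable_nn_integral_lborel:
  fixes f :: "'a::euclidean_space \<times> 'b::euclidean_space \<Rightarrow> ennreal"
  assumes "f \<in> borel_measurable borel"
  shows "(\<lambda>x. \<integral>\<^sup>+y. f (x, y) \<partial>lborel) \<in> borel_measurable borel"
  using lborel.borel_measurable_nn_integral_fst[of f lborel] assms by (simp add: lborel_prod)

lemma AE_lborel_pairD:
  fixes P :: "'a::euclidean_space \<times> 'b::euclidean_space \<Rightarrow> bool"
  assumes "AE z in lborel. P z"
  shows "AE x in lborel. AE y in lborel. P (x, y)"
  using assms lborel_pair.AE_pair[of P] lborel_prod by metis

lemma AE_lborel_pairI:
  fixes P :: "'a::euclidean_space \<times> 'b::euclidean_space \<Rightarrow> bool"
  assumes "Measurable.pred borel P" "AE x in lborel. AE y in lborel. P (x, y)"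
  shows "AE z in lborel. P z"
proof -
  have "{z \<in> space (lborel \<Otimes>\<^sub>M lborel). P z} \<in> sets (lborel \<Otimes>\<^sub>M lborel)"
    unfolding lborel_prod using assms(1) by (simp add: pred_def)
  from lborel_pair.AE_pair_measure[OF this assms(2)] show ?thesis
    by (simp only: lborel_prod)
qed

text \<open>Characteristic coordinates: a phase point at time 0 and a time. Free transport becomes
  motion in the second coordinate alone.\<close>

definition along_flow :: "'n::finite phase \<times> real \<Rightarrow> 'n phase_time" where
  "along_flow = (\<lambda>((v, x), t). (v, x + t *\<^sub>R v, t))"

lemma along_flow_apply [simp]: "along_flow ((v, x), t) = (v, x + t *\<^sub>R v, t)"
  by (simp add: along_flow_def)

lemma continuous_on_along_flow: "continuous_on UNIV along_flow"
  unfolding along_flow_def split_beta' by (intro continuous_intros)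

lemma measurable_along_flow [measurable]: "along_flow \<in> borel \<rightarrow>\<^sub>M borel"
  by (rule borel_measurable_continuous_onI[OF continuous_on_along_flow])

lemma measurable_along_flow_compose:
  "f \<in> borel \<rightarrow>\<^sub>M N \<Longrightarrow> (\<lambda>q. f (along_flow q)) \<in> borel \<rightarrow>\<^sub>M N"
  by (rule measurable_compose[OF measurable_along_flow])

text \<open>For fixed \<open>v\<close> and \<open>t\<close> the map only shifts \<open>x\<close> by
  \<open>t *\<^sub>R v\<close>; the integrals over \<open>x\<close> and \<open>t\<close> are
  exchanged to make that shift innermost, and exchanged back.\<close>

lemma nn_integral_along_flow:
  fixes f :: "'n::finite phase_time \<Rightarrow> ennreal"
  assumes f[measurable]: "f \<in> borel_measurable borel"
  shows "(\<integral>\<^sup>+p. \<integral>\<^sup>+t. f (along_flow (p, t)) \<partial>lborel \<partial>lborel) = (\<integral>\<^sup>+z. f z \<partial>lborel)"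
proof -
  note [measurable] = measurable_along_flow_compose[OF f]
  have pair: "(\<lambda>y. f (v, y)) \<in> borel_measurable borel" for v
    by (rule measurable_compose[OF borel_measurable_continuous_onI f]) (intro continuous_intros)
  have m: "(\<lambda>z. f (v, fst z, snd z)) \<in> borel_measurable borel" for v
    using pair[of v] by simp
  have m': "(\<lambda>z. f (v, fst z + snd z *\<^sub>R v, snd z)) \<in> borel_measurable borel" for v
    by (rule measurable_compose[OF borel_measurable_continuous_onI f]) (intro continuous_intros)
  have "(\<integral>\<^sup>+p. \<integral>\<^sup>+t. f (along_flow (p, t)) \<partial>lborel \<partial>lborel)
      = (\<integral>\<^sup>+v. \<integral>\<^sup>+x. \<integral>\<^sup>+t. f (along_flow ((v, x), t)) \<partial>lborel \<partial>lborel \<partial>lborel)"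
    by (intro nn_integral_lborel_pair measurable_nn_integral_lborel) simp
  also have "\<dots> = (\<integral>\<^sup>+v. \<integral>\<^sup>+t. \<integral>\<^sup>+x. f (v, x + t *\<^sub>R v, t) \<partial>lborel \<partial>lborel \<partial>lborel)"
    unfolding along_flow_apply by (intro nn_integral_cong nn_integral_lborel_swap m')
  also have "\<dots> = (\<integral>\<^sup>+v. \<integral>\<^sup>+t. \<integral>\<^sup>+x. f (v, x, t) \<partial>lborel \<partial>lborel \<partial>lborel)"
  proof (rule nn_integral_cong, rule nn_integral_cong)
    fix v :: "real ^ 'n" and t :: real
    have "(\<lambda>x. f (v, x, t)) \<in> borel_measurable borel"
      by (rule measurable_compose[OF borel_measurable_continuous_onI f]) (intro continuous_intros)
    from nn_integral_lborel_translate[OF this, of "t *\<^sub>R v"]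
    show "(\<integral>\<^sup>+x. f (v, x + t *\<^sub>R v, t) \<partial>lborel) = (\<integral>\<^sup>+x. f (v, x, t) \<partial>lborel)"
      by (simp add: add.commute)
  qed
  also have "\<dots> = (\<integral>\<^sup>+v. \<integral>\<^sup>+x. \<integral>\<^sup>+t. f (v, x, t) \<partial>lborel \<partial>lborel \<partial>lborel)"
    by (intro nn_integral_cong nn_integral_lborel_swap[symmetric] m)
  also have "\<dots> = (\<integral>\<^sup>+v. \<integral>\<^sup>+y. f (v, y) \<partial>lborel \<partial>lborel)"
    by (intro nn_integral_cong nn_integral_lborel_pair[symmetric] pair)
  also have "\<dots> = (\<integral>\<^sup>+z. f z \<partial>lborel)"
    by (rule nn_integral_lborel_pair[symmetric, OF f])
  finally show ?thesis .
qed

lemma distr_along_flow: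
  "distr lborel borel along_flow = (lborel :: 'n::finite phase_time measure)"
proof (rule measure_eqI)
  fix A :: "'n phase_time set" assume "A \<in> sets (distr lborel borel along_flow)"
  then have [measurable]: "A \<in> sets borel" by simp
  have m: "(\<lambda>z. indicator A z :: ennreal) \<in> borel_measurable borel" by measurable
  have "emeasure (distr lborel borel along_flow) A = (\<integral>\<^sup>+q. indicator A (along_flow q) \<partial>lborel)"
    by (simp add: nn_integral_distr flip: nn_integral_indicator)
  also have "\<dots> = (\<integral>\<^sup>+p. \<integral>\<^sup>+t. indicator A (along_flow (p, t)) \<partial>lborel \<partial>lborel)"
    by (rule nn_integral_lborel_pair[OF measurable_along_flow_compose[OF m]])
  finally show "emeasure (distr lborel borel along_flow) A = emeasure lborel A"
    using nn_integral_along_flow[OF m] by simp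
qed simp

lemma AE_along_flow:
  fixes P :: "'n::finite phase_time \<Rightarrow> bool"
  assumes "AE z in lborel. P z"
  shows "AE p in lborel. AE t in lborel. P (along_flow (p, t))"
proof -
  have "AE z in distr lborel borel along_flow. P z"
    using assms distr_along_flow by metis
  then have "AE q in lborel. P (along_flow q)"
    by (rule AE_distrD[rotated]) simp
  then show ?thesis by (rule AE_lborel_pairD)
qed

text \<open>The hypothesis has the quantifier order of a mild solution, one null set of
  characteristics for all times; the conclusion is the form in which the weighted bounds on
  \<open>F\<close> are stated.\<close>

lemma AE_of_along_flow:
  fixes P :: "'n::finite phase_time \<Rightarrow> bool"
  assumes P: "Measurable.pred borel P" and ae: "AE p in lborel. \<forall>t. P (along_flow (p, t))"
  shows "AE z in lborel. P z"
proof -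
  have "AE q in lborel. P (along_flow q)"
    by (rule AE_lborel_pairI[OF measurable_along_flow_compose[OF P]]) (use ae in eventually_elim, simp)
  then have "AE z in distr lborel borel along_flow. P z"
    using P by (subst AE_distr_iff) (simp_all add: pred_def)
  then show ?thesis
    using distr_along_flow by metis
qed

section \<open>Measurability and null sets in the collision variables\<close>

lemma measurable_sphere_measureD:
  "f \<in> borel_measurable borel \<Longrightarrow> f \<in> borel_measurable sphere_measure"
  unfolding measurable_cong_sets[OF sets_sphere_measure refl] by (rule measurable_restrict_space1)

lemma measurable_sphere_lborel:
  assumes "f \<in> borel \<rightarrow>\<^sub>M M"
  shows "f \<in> sphere_measure \<Otimes>\<^sub>M lborel \<rightarrow>\<^sub>M M"
proof -
  have "(\<lambda>p. (fst p, snd p)) \<in> sphere_measure \<Otimes>\<^sub>M lborel \<rightarrow>\<^sub>M borel \<Otimes>\<^sub>M borel"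
    by (intro measurable_Pair measurable_compose[OF measurable_fst measurable_sphere_measureD]) simp_all
  then show ?thesis
    using assms by (auto intro: measurable_compose simp: borel_prod)
qed

lemma borel_measurable_sgn_vec [measurable]: "(sgn :: real ^ 'n \<Rightarrow> _) \<in> borel_measurable borel"
  unfolding sgn_div_norm by measurable

lemma separated_kernel_measurable [measurable]:
  assumes [measurable]: "bhat \<in> borel_measurable borel"
    "f \<in> borel_measurable M" "g \<in> borel_measurable M"
  shows "(\<lambda>y. separated_kernel \<beta> bhat (f y) (g y)) \<in> borel_measurable M"
  unfolding separated_kernel_def by measurable

lemma collision_integrand_measurable:
  assumes bhat[measurable]: "bhat \<in> borel_measurable borel" and F[measurable]: "F \<in> borel_measurable borel"
  shows "(\<lambda>(z, p). collision_integrand (separated_kernel \<beta> bhat) F z p) \<in> borel_measurable (borel \<Otimes>\<^sub>M borel)"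
  unfolding collision_integrand_def Let_def split_beta' borel_prod[symmetric]
  by measurable

interpretation lborel_sphere_lborel: pair_sigma_finite "lborel :: 'b::euclidean_space measure"
  "sphere_measure \<Otimes>\<^sub>M lborel :: ((real ^ 'n) \<times> 'a::euclidean_space) measure"
  ..

text \<open>For each \<open>\<omega>\<close> Lebesgue null sets are translation invariant. This
  leads back from the relative velocity \<open>u = w - v\<close> to \<open>w\<close>.\<close>

lemma AE_sphere_lborel_translate:
  fixes a :: "real ^ 'n"
  assumes Q: "Measurable.pred borel Q" and ae: "AE p in sphere_measure \<Otimes>\<^sub>M lborel. Q (fst p, a + snd p)"
  shows "AE p in sphere_measure \<Otimes>\<^sub>M lborel. Q p"
proof (rule sphere_lborel.AE_pair_measure)
  have "Q \<in> sphere_measure \<Otimes>\<^sub>M lborel \<rightarrow>\<^sub>M count_space UNIV"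
    using Q by (rule measurable_sphere_lborel)
  then show "{p \<in> space (sphere_measure \<Otimes>\<^sub>M lborel). Q p} \<in> sets (sphere_measure \<Otimes>\<^sub>M lborel)"
    by (simp add: pred_def)
  have "AE \<omega> in sphere_measure. AE u in lborel. Q (\<omega>, a + u)"
    using sphere_lborel.AE_pair[OF ae] by simp
  then show "AE \<omega> in sphere_measure. AE w in lborel. Q (\<omega>, w)"
    by eventually_elim (drule AE_lborel_translate[where a="- a"], simp)
qed

text \<open>With \<open>w = v + u\<close> and \<open>(\<omega>, u)\<close> fixed, each of the velocities \<open>v'\<close>, \<open>w'\<close>, \<open>w\<close> is a translate of \<open>v\<close>,
  so null sets of \<open>(v, x, t)\<close> are pulled back to null sets.\<close>

lemma collision_integrand_AE_cong:
  fixes F G :: "'n::finite phase_time \<Rightarrow> real" and \<beta> :: real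
  assumes bhat[measurable]: "bhat \<in> borel_measurable borel"
    and F[measurable]: "F \<in> borel_measurable borel" and G[measurable]: "G \<in> borel_measurable borel"
    and eq: "AE z in lborel. F z = G z"
  defines "b \<equiv> separated_kernel \<beta> bhat"
  shows "AE z in lborel. AE p in sphere_measure \<Otimes>\<^sub>M lborel.
    collision_integrand b F z p = collision_integrand b G z p"
proof -
  let ?R = "\<lambda>z p. collision_integrand b F z p = collision_integrand b G z p"
  have R: "Measurable.pred (borel \<Otimes>\<^sub>M borel) (\<lambda>y. ?R (fst y) (snd y))"
    using collision_integrand_measurable[OF bhat F, of \<beta>] collision_integrand_measurable[OF bhat G, of \<beta>]
    unfolding b_def split_beta' by measurable
  have shift: "AE z in lborel. F (fst z + a, snd z) = G (fst z + a, snd z)" for a :: "real ^ 'n"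
    using AE_lborel_translate[OF eq, of "(a, 0)"] by (simp add: plus_prod_def add.commute)
  have all: "AE z in lborel. ?R z (\<omega>, fst z + u)" for \<omega> u :: "real ^ 'n"
    using shift[of "(u \<bullet> \<omega>) *\<^sub>R \<omega>"] shift[of "u - (u \<bullet> \<omega>) *\<^sub>R \<omega>"] shift[of 0] shift[of u]
  proof eventually_elim
    case (elim z)
    obtain v x t where z: "z = (v, x, t)" by (cases z) auto
    have "v - ((v - (v + u)) \<bullet> \<omega>) *\<^sub>R \<omega> = v + (u \<bullet> \<omega>) *\<^sub>R \<omega>"
      "v + u + ((v - (v + u)) \<bullet> \<omega>) *\<^sub>R \<omega> = v + (u - (u \<bullet> \<omega>) *\<^sub>R \<omega>)"
      by (simp_all add: algebra_simps)
    then show ?case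
      using elim by (simp add: z collision_integrand_def add_diff_eq)
  qed
  have "AE z in lborel. AE p in sphere_measure \<Otimes>\<^sub>M lborel. ?R z (fst p, fst z + snd p)"
  \<comment> \<open>\<open>all\<close> holds for every \<open>(\<omega>, u)\<close> and almost every
    \<open>z\<close>. Exchanging the two quantifiers by Fubini requires joint measurability of the
    shifted relation.\<close>
  proof (subst lborel_sphere_lborel.AE_commute)
    have "(\<lambda>y :: 'n phase_time \<times> 'n phase. (fst y, fst (snd y), fst (fst y) + snd (snd y))) \<in> borel \<rightarrow>\<^sub>M borel \<Otimes>\<^sub>M borel"
      unfolding borel_prod by (intro borel_measurable_continuous_onI continuous_intros)
    moreover have "(\<lambda>y :: 'n phase_time \<times> 'n phase. (fst y, snd y)) \<in> lborel \<Otimes>\<^sub>M (sphere_measure \<Otimes>\<^sub>M lborel) \<rightarrow>\<^sub>M borel"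
      unfolding borel_prod[symmetric, where 'a="'n phase_time"]
      by (intro measurable_Pair measurable_compose[OF measurable_snd measurable_sphere_lborel]) simp_all
    ultimately have "(\<lambda>y :: 'n phase_time \<times> 'n phase. (fst y, fst (snd y), fst (fst y) + snd (snd y)))
        \<in> lborel \<Otimes>\<^sub>M (sphere_measure \<Otimes>\<^sub>M lborel) \<rightarrow>\<^sub>M borel \<Otimes>\<^sub>M borel"
      using measurable_compose by fastforce
    from measurable_compose[OF this R]
    show "{y \<in> space (lborel \<Otimes>\<^sub>M (sphere_measure \<Otimes>\<^sub>M lborel)). ?R (fst y) (fst (snd y), fst (fst y) + snd (snd y))}
        \<in> sets (lborel \<Otimes>\<^sub>M (sphere_measure \<Otimes>\<^sub>M lborel))"
      by (simp add: pred_def)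
  qed (simp add: all)
  then show ?thesis
  proof eventually_elim
    case (elim z)
    have "Measurable.pred borel (?R z)"
      using measurable_compose[OF measurable_Pair1'[of z borel borel] R] by simp
    then show ?case
      using elim by (rule AE_sphere_lborel_translate)
  qed
qed

section \<open>Time integrals, products and weighted norms\<close>

lemma abs_interval_integral_le:
  fixes f :: "real \<Rightarrow> real"
  assumes f: "f \<in> borel_measurable borel" and K: "(\<integral>\<^sup>+s. ennreal \<bar>f s\<bar> \<partial>lborel) \<le> ennreal K" "0 \<le> K"
  shows "\<bar>LBINT s=ereal t1..ereal t2. f s\<bar> \<le> K"
proof -
  have int: "integrable lborel f"
    by (rule integrableI_bounded) (use f K in \<open>auto intro: le_less_trans\<close>)
  have "\<bar>LINT s:S|lborel. f s\<bar> \<le> K" if "S \<in> sets borel" for S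
  proof -
    have "\<bar>LINT s:S|lborel. f s\<bar> \<le> (LINT s|lborel. norm (indicator S s *\<^sub>R f s))"
      unfolding set_lebesgue_integral_def real_norm_def[symmetric] by (rule integral_norm_bound)
    also have "\<dots> \<le> (LINT s|lborel. norm (f s))"
      using that int by (intro integral_mono integrable_norm integrable_mult_indicator) (auto simp: indicator_def)
    also have "\<dots> \<le> K"
      using K int by (simp add: integral_eq_nn_integral enn2real_leI)
    finally show ?thesis .
  qed
  then show ?thesis
    by (simp add: interval_lebesgue_integral_def)
qed

text \<open>The endpoint moves into the integrand as a sign factor that is jointly measurable in
  \<open>s\<close> and \<open>t\<close>, so measurability of parameter integrals applies when the
  endpoint varies with the point.\<close>

lemma interval_integral_eq_signed:
  fixes f :: "real \<Rightarrow> real"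
  shows "(LBINT s=ereal 0..ereal t. f s)
    = (LINT s|lborel. (if 0 < s \<and> s < t then 1 else if t < s \<and> s < 0 then - 1 else 0) * f s)"
proof (cases "0 \<le> t")
  case True
  then show ?thesis
    unfolding interval_lebesgue_integral_def set_lebesgue_integral_def
    by (auto intro!: Bochner_Integration.integral_cong simp: indicator_def)
next
  case False
  then show ?thesis
    unfolding interval_lebesgue_integral_def set_lebesgue_integral_def
    by (auto intro!: Bochner_Integration.integral_cong simp: indicator_def simp flip: Bochner_Integration.integral_minus)
qed

text \<open>Telescoping needs a size bound for one factor of each product only, \<open>x\<close> and
  \<open>y'\<close>; hence the constant \<open>p + q\<close>.\<close>

lemma abs_mult_diff_le:
  fixes x y x' y' :: real
  assumes "\<bar>x\<bar> \<le> p * m" "\<bar>y'\<bar> \<le> q * m'" "\<bar>x - x'\<bar> \<le> k * m" "\<bar>y - y'\<bar> \<le> k * m'"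
    and "0 \<le> p" "0 \<le> q" "0 \<le> k" "0 \<le> m" "0 \<le> m'"
  shows "\<bar>x * y - x' * y'\<bar> \<le> (p + q) * k * (m * m')"
proof -
  have "x * y - x' * y' = x * (y - y') + (x - x') * y'" by (simp add: algebra_simps)
  then have "\<bar>x * y - x' * y'\<bar> \<le> \<bar>x\<bar> * \<bar>y - y'\<bar> + \<bar>x - x'\<bar> * \<bar>y'\<bar>"
    by (metis abs_mult abs_triangle_ineq)
  also have "\<dots> \<le> (p * m) * (k * m') + (k * m) * (q * m')"
    using assms by (intro add_mono mult_mono) auto
  finally show ?thesis by (simp add: algebra_simps)
qed

lemma AE_lborel_trivialD:
  assumes "AE x in (lborel :: 'a::euclidean_space measure). P"
  shows P
  using assms eventually_const[of "ae_filter (lborel :: 'a measure)" P]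
  by (simp add: ae_filter_eq_bot_iff)

lemma weighted_norm_nonneg:
  fixes W f :: "'a::euclidean_space \<Rightarrow> real"
  shows "0 \<le> weighted_norm W f"
proof -
  have "AE z in (lborel :: 'a measure). 0 \<le> esssup lborel (\<lambda>z. ereal \<bar>f z / W z\<bar>)"
    using esssup_AE[of "\<lambda>z. ereal \<bar>f z / W z\<bar>" lborel]
    by eventually_elim (rule order_trans[rotated], auto)
  then have "0 \<le> esssup lborel (\<lambda>z. ereal \<bar>f z / W z\<bar>)" by (rule AE_lborel_trivialD)
  then show ?thesis by (simp add: weighted_norm_def real_of_ereal_pos)
qed

text \<open>Finiteness of the essential supremum matters, since \<open>weighted_norm\<close> sends
  an infinite one to 0.\<close>

lemma weighted_normD:
  assumes f: "f \<in> weighted_Linf W" and W: "\<And>z. 0 < W z"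
  shows "AE z in lborel. \<bar>f z\<bar> \<le> weighted_norm W f * W z"
proof -
  let ?e = "esssup lborel (\<lambda>z. ereal \<bar>f z / W z\<bar>)"
  have "?e < \<infinity>" using f by (simp add: weighted_Linf_def)
  show ?thesis
    using esssup_AE[of "\<lambda>z. ereal \<bar>f z / W z\<bar>" lborel]
  proof eventually_elim
    case (elim z)
    then have "\<bar>f z / W z\<bar> \<le> weighted_norm W f"
      using \<open>?e < \<infinity>\<close> unfolding weighted_norm_def by (cases ?e) auto
    then show ?case
      using W[of z] by (simp add: abs_divide abs_of_pos pos_divide_le_eq)
  qed
qed

lemma weighted_normI:
  assumes f[measurable]: "f \<in> borel_measurable lborel" and W[measurable]: "W \<in> borel_measurable lborel" "\<And>z. 0 < W z"
    and le: "AE z in lborel. \<bar>f z\<bar> \<le> c * W z" and c: "0 \<le> c"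
  shows "f \<in> weighted_Linf W" and "weighted_norm W f \<le> c"
proof -
  have "esssup lborel (\<lambda>z. ereal \<bar>f z / W z\<bar>) \<le> ereal c"
  proof (rule esssup_I)
    show "AE z in lborel. ereal \<bar>f z / W z\<bar> \<le> ereal c"
      using le by eventually_elim (simp add: abs_divide abs_of_pos W(2) pos_divide_le_eq)
  qed simp
  then show "f \<in> weighted_Linf W" "weighted_norm W f \<le> c"
    unfolding weighted_Linf_def weighted_norm_def using f c
    by (cases "esssup lborel (\<lambda>z. ereal \<bar>f z / W z\<bar>)"; simp)+
qed

subsection \<open>Bounds for the collision integral\<close>

text \<open>All that the fixed-point argument uses about a Maxwellian and the kernel. The Gaussian
  form of \<open>M\<close> serves only to establish these properties.\<close>

locale dominating_weight =
  fixes \<beta> bbar :: real and bhat :: "real \<Rightarrow> real" and M :: "'n::finite phase_time \<Rightarrow> real"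
  assumes bhat_measurable [measurable]: "bhat \<in> borel_measurable borel"
    and bhat_nonneg: "\<And>y. 0 \<le> bhat y"
    and bbar_nonneg: "0 \<le> bbar"
    and bhat_nn_integral: "\<And>e :: real ^ 'n. norm e = 1 \<Longrightarrow> (\<integral>\<^sup>+\<omega>. ennreal (bhat (\<omega> \<bullet> e)) \<partial>sphere_measure) = ennreal bbar"
    and weight_pos: "\<And>z. 0 < M z"
    and weight_continuous: "continuous_on UNIV M"
    and weight_transport: "\<And>v x s t. M (v, x + s *\<^sub>R v, t + s) = M (v, x, t)"
    and weight_balance: "\<And>v w x t \<omega>. norm \<omega> = 1 \<Longrightarrow>
      M (v - ((v - w) \<bullet> \<omega>) *\<^sub>R \<omega>, x, t) * M (w + ((v - w) \<bullet> \<omega>) *\<^sub>R \<omega>, x, t) = M (v, x, t) * M (w, x, t)"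
    and weight_moment: "\<And>v x t. integrable lborel (\<lambda>w. M (w, x, t) * norm (v - w) powr \<beta>)"
    and nu_finite: "nu \<beta> bbar M < \<infinity>"
begin

abbreviation b :: "real ^ 'n \<Rightarrow> real ^ 'n \<Rightarrow> real" where
  "b \<equiv> separated_kernel \<beta> bhat"

abbreviation \<nu> :: real where
  "\<nu> \<equiv> enn2real (nu \<beta> bbar M)"

lemma weight_measurable [measurable]: "M \<in> borel_measurable borel"
  by (rule borel_measurable_continuous_onI[OF weight_continuous])

lemma weight_along_flow: "M (along_flow (p, t)) = at_time M 0 p"
  using weight_transport[of "fst p" "snd p" t 0] by (cases p) (simp add: at_time_def)

lemma attenuation_nonneg: "0 \<le> attenuation \<beta> bbar M z"
  using bbar_nonneg weight_pos by (cases z) (simp add: attenuation_def less_imp_le)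

lemma attenuation_measurable [measurable]: "attenuation \<beta> bbar M \<in> borel_measurable borel"
  unfolding attenuation_def split_beta' borel_prod[symmetric] by measurable

lemma kernel_nonneg: "0 \<le> b z \<omega>"
  by (simp add: separated_kernel_def bhat_nonneg)

lemma loss_measurable: "(\<lambda>(\<omega>, w). M (w, x, t) * b (v - w) \<omega>) \<in> borel_measurable (sphere_measure \<Otimes>\<^sub>M lborel)"
  by (rule measurable_sphere_lborel) (unfold split_beta' borel_prod[symmetric], measurable)

text \<open>Tonelli with the angular integral innermost: it produces
  \<open>norm (v - w) powr \<beta>\<close> times \<open>bbar\<close> whatever the direction of
  \<open>v - w\<close>. For \<open>w = v\<close> both sides vanish because
  \<open>0 powr \<beta> = 0\<close>.\<close>

lemma loss_nn_integral:
  "(\<integral>\<^sup>+(\<omega>, w). ennreal (M (w, x, t) * b (v - w) \<omega>) \<partial>(sphere_measure \<Otimes>\<^sub>M lborel))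
    = ennreal (attenuation \<beta> bbar M (v, x, t))"
proof -
  have inner: "(\<integral>\<^sup>+\<omega>. ennreal (M (w, x, t) * b (v - w) \<omega>) \<partial>sphere_measure)
      = ennreal (M (w, x, t) * norm (v - w) powr \<beta>) * ennreal bbar" for w
  proof (cases "v = w")
    case False
    have [measurable]: "(\<lambda>\<omega>. bhat (\<omega> \<bullet> sgn (v - w))) \<in> borel_measurable sphere_measure"
      by (rule measurable_sphere_measureD) measurable
    have "(\<integral>\<^sup>+\<omega>. ennreal (M (w, x, t) * b (v - w) \<omega>) \<partial>sphere_measure)
        = (\<integral>\<^sup>+\<omega>. ennreal (M (w, x, t) * norm (v - w) powr \<beta>) * ennreal (bhat (\<omega> \<bullet> sgn (v - w))) \<partial>sphere_measure)"
      using weight_pos bhat_nonneg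
      by (intro nn_integral_cong) (simp add: separated_kernel_def mult.assoc less_imp_le flip: ennreal_mult)
    also have "\<dots> = ennreal (M (w, x, t) * norm (v - w) powr \<beta>) * ennreal bbar"
      using False by (subst nn_integral_cmult) (simp_all add: bhat_nn_integral norm_sgn)
    finally show ?thesis .
  qed (simp add: separated_kernel_def)
  have "(\<integral>\<^sup>+(\<omega>, w). ennreal (M (w, x, t) * b (v - w) \<omega>) \<partial>(sphere_measure \<Otimes>\<^sub>M lborel))
      = (\<integral>\<^sup>+w. \<integral>\<^sup>+\<omega>. ennreal (M (w, x, t) * b (v - w) \<omega>) \<partial>sphere_measure \<partial>lborel)"
    using loss_measurable[of x t v]
    by (subst sphere_lborel.nn_integral_snd[symmetric]) (simp_all add: split_beta')
  also have "\<dots> = (\<integral>\<^sup>+w. ennreal (M (w, x, t) * norm (v - w) powr \<beta>) \<partial>lborel) * ennreal bbar"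
    unfolding inner by (rule nn_integral_multc) measurable
  also have "\<dots> = ennreal (attenuation \<beta> bbar M (v, x, t))"
    using weight_pos bbar_nonneg
    by (subst nn_integral_eq_integral[OF weight_moment])
      (simp_all add: attenuation_def less_imp_le mult.commute flip: ennreal_mult)
  finally show ?thesis .
qed

lemma loss_integral:
  shows "integrable (sphere_measure \<Otimes>\<^sub>M lborel) (\<lambda>(\<omega>, w). M (w, x, t) * b (v - w) \<omega>)"
    and "(LINT (\<omega>, w)|(sphere_measure \<Otimes>\<^sub>M lborel). M (w, x, t) * b (v - w) \<omega>) = attenuation \<beta> bbar M (v, x, t)"
proof -
  have nn: "0 \<le> (case p of (\<omega>, w) \<Rightarrow> M (w, x, t) * b (v - w) \<omega>)" for p
    using weight_pos kernel_nonneg by (simp add: split_beta' less_imp_le)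
  have eq: "(\<integral>\<^sup>+p. ennreal (case p of (\<omega>, w) \<Rightarrow> M (w, x, t) * b (v - w) \<omega>) \<partial>(sphere_measure \<Otimes>\<^sub>M lborel))
      = ennreal (attenuation \<beta> bbar M (v, x, t))"
    using loss_nn_integral[of x t v] by (simp add: split_beta')
  show "integrable (sphere_measure \<Otimes>\<^sub>M lborel) (\<lambda>(\<omega>, w). M (w, x, t) * b (v - w) \<omega>)"
    by (rule integrableI_nonneg[OF loss_measurable]) (use nn eq in auto)
  show "(LINT (\<omega>, w)|(sphere_measure \<Otimes>\<^sub>M lborel). M (w, x, t) * b (v - w) \<omega>) = attenuation \<beta> bbar M (v, x, t)"
    by (subst integral_eq_nn_integral[OF loss_measurable]) (use nn eq attenuation_nonneg in auto)
qed

text \<open>The bound is demanded at every point, because the collision integrand evaluates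
  \<open>F\<close> at several velocities for each \<open>z\<close>.\<close>

definition dominated :: "real \<Rightarrow> ('n phase_time \<Rightarrow> real) \<Rightarrow> bool" where
  "dominated p F \<longleftrightarrow> F \<in> borel_measurable borel \<and> 0 \<le> p \<and> (\<forall>z. \<bar>F z\<bar> \<le> p * M z)"

lemma dominatedD:
  assumes "dominated p F"
  shows "F \<in> borel_measurable borel" "0 \<le> p" "\<bar>F z\<bar> \<le> p * M z"
  using assms unfolding dominated_def by blast+

lemma dominated_zero: "dominated 0 (\<lambda>_. 0)"
  by (simp add: dominated_def)

lemma dominated_weight: "dominated 1 M"
  using weight_pos by (simp add: dominated_def abs_of_pos)

text \<open>By \<open>weight_balance\<close> the gain products carry the same weight
  \<open>M (v, x, t) * M (w, x, t)\<close> as the loss products; the factor 2 counts the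
  two.\<close>

lemma collision_integrand_diff_le:
  assumes F: "dominated p F" and G: "dominated q G" and FG: "dominated k (\<lambda>z. F z - G z)"
    and \<omega>: "norm \<omega> = 1"
  shows "\<bar>collision_integrand b F (v, x, t) (\<omega>, w) - collision_integrand b G (v, x, t) (\<omega>, w)\<bar>
    \<le> 2 * (p + q) * k * M (v, x, t) * (M (w, x, t) * b (v - w) \<omega>)"
proof -
  define v' w' where "v' = v - ((v - w) \<bullet> \<omega>) *\<^sub>R \<omega>" and "w' = w + ((v - w) \<bullet> \<omega>) *\<^sub>R \<omega>"
  have prod: "\<bar>F (y, x, t) * F (y', x, t) - G (y, x, t) * G (y', x, t)\<bar>
      \<le> (p + q) * k * (M (y, x, t) * M (y', x, t))" for y y'
    by (rule abs_mult_diff_le) (use dominatedD[OF F] dominatedD[OF G] dominatedD[OF FG] weight_pos in \<open>simp_all add: less_imp_le\<close>)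
  have bal: "M (v', x, t) * M (w', x, t) = M (v, x, t) * M (w, x, t)"
    unfolding v'_def w'_def by (rule weight_balance[OF \<omega>])
  have "collision_integrand b F (v, x, t) (\<omega>, w) - collision_integrand b G (v, x, t) (\<omega>, w)
      = ((F (v', x, t) * F (w', x, t) - G (v', x, t) * G (w', x, t))
        - (F (v, x, t) * F (w, x, t) - G (v, x, t) * G (w, x, t))) * b (v - w) \<omega>"
    unfolding collision_integrand_def split_conv Let_def v'_def[symmetric] w'_def[symmetric]
    by (simp add: left_diff_distrib)
  then have "\<bar>collision_integrand b F (v, x, t) (\<omega>, w) - collision_integrand b G (v, x, t) (\<omega>, w)\<bar>
      = \<bar>(F (v', x, t) * F (w', x, t) - G (v', x, t) * G (w', x, t))
        - (F (v, x, t) * F (w, x, t) - G (v, x, t) * G (w, x, t))\<bar> * b (v - w) \<omega>"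
    using kernel_nonneg[of "v - w" \<omega>] by (simp only: abs_mult abs_of_nonneg)
  also have "\<dots> \<le> (2 * (p + q) * k * (M (v, x, t) * M (w, x, t))) * b (v - w) \<omega>"
    using prod[of v' w'] prod[of v w] unfolding bal
    by (intro mult_right_mono kernel_nonneg) linarith
  finally show ?thesis by (simp add: mult.assoc)
qed

lemma collision_integrand_measurable_snd:
  assumes "F \<in> borel_measurable borel"
  shows "collision_integrand b F z \<in> borel_measurable (sphere_measure \<Otimes>\<^sub>M lborel)"
proof (rule measurable_sphere_lborel)
  show "collision_integrand b F z \<in> borel_measurable borel"
    using measurable_compose[OF measurable_Pair1'[of z borel borel]
        collision_integrand_measurable[OF bhat_measurable assms, of \<beta>]] by (simp add: borel_prod)
qed

lemma collision_measurable:
  assumes F: "F \<in> borel_measurable borel"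
  shows "collision b F \<in> borel_measurable borel"
proof -
  have "(\<lambda>y. (fst y, snd y)) \<in> borel \<Otimes>\<^sub>M (sphere_measure \<Otimes>\<^sub>M lborel) \<rightarrow>\<^sub>M (borel \<Otimes>\<^sub>M borel :: ('n phase_time \<times> 'n phase) measure)"
    by (intro measurable_Pair measurable_compose[OF measurable_snd measurable_sphere_lborel]) simp_all
  from measurable_compose[OF this collision_integrand_measurable[OF bhat_measurable F, of \<beta>]]
  show ?thesis
    unfolding collision_def by (intro sphere_lborel.borel_measurable_lebesgue_integral) (simp add: split_beta')
qed

lemma sphere_lborel_norm:
  "p \<in> space (sphere_measure \<Otimes>\<^sub>M lborel) \<Longrightarrow> norm (fst p) = 1"
  by (auto simp: space_pair_measure)

lemma collision_integrand_zero [simp]: "collision_integrand b (\<lambda>_. 0) z p = 0"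
  by (simp add: collision_integrand_def split_beta')

text \<open>This is comparison with the zero function: \<open>G = 0\<close>, \<open>q = 0\<close>
  and \<open>k = p\<close> in the difference bound.\<close>

lemma collision_integrand_integrable:
  assumes F: "dominated p F"
  shows "integrable (sphere_measure \<Otimes>\<^sub>M lborel) (collision_integrand b F z)"
proof -
  obtain v x t where z: "z = (v, x, t)" by (cases z) auto
  show ?thesis
  proof (rule Bochner_Integration.integrable_bound)
    show "integrable (sphere_measure \<Otimes>\<^sub>M lborel)
        (\<lambda>y. 2 * (p + 0) * p * M (v, x, t) * (case y of (\<omega>, w) \<Rightarrow> M (w, x, t) * b (v - w) \<omega>))"
      by (intro integrable_mult_right loss_integral)
    show "collision_integrand b F z \<in> borel_measurable (sphere_measure \<Otimes>\<^sub>M lborel)"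
      by (rule collision_integrand_measurable_snd[OF dominatedD(1)[OF F]])
    show "AE y in sphere_measure \<Otimes>\<^sub>M lborel. norm (collision_integrand b F z y)
        \<le> norm (2 * (p + 0) * p * M (v, x, t) * (case y of (\<omega>, w) \<Rightarrow> M (w, x, t) * b (v - w) \<omega>))"
    proof (rule AE_I2)
      fix y assume y: "y \<in> space (sphere_measure \<Otimes>\<^sub>M lborel :: 'n phase measure)"
      obtain \<omega> w where yw: "y = (\<omega>, w)" by (cases y)
      have "\<bar>collision_integrand b F z y\<bar> \<le> 2 * (p + 0) * p * M (v, x, t) * (M (w, x, t) * b (v - w) \<omega>)"
        using collision_integrand_diff_le[OF F dominated_zero, of p \<omega> v x t w] F sphere_lborel_norm[OF y]
        by (simp add: z yw)
      then show "norm (collision_integrand b F z y)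
          \<le> norm (2 * (p + 0) * p * M (v, x, t) * (case y of (\<omega>, w) \<Rightarrow> M (w, x, t) * b (v - w) \<omega>))"
        by (simp add: yw)
    qed
  qed
qed

lemma collision_diff_le:
  assumes F: "dominated p F" and G: "dominated q G" and FG: "dominated k (\<lambda>z. F z - G z)"
  shows "\<bar>collision b F z - collision b G z\<bar> \<le> 2 * (p + q) * k * M z * attenuation \<beta> bbar M z"
proof -
  obtain v x t where z: "z = (v, x, t)" by (cases z) auto
  let ?S = "sphere_measure \<Otimes>\<^sub>M lborel :: 'n phase measure"
  have "\<bar>collision b F z - collision b G z\<bar>
      = norm (LINT y|?S. collision_integrand b F z y - collision_integrand b G z y)"
    by (simp add: collision_def Bochner_Integration.integral_diff collision_integrand_integrable[OF F] collision_integrand_integrable[OF G])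
  also have "\<dots> \<le> (LINT y|?S. norm (collision_integrand b F z y - collision_integrand b G z y))"
    by (rule integral_norm_bound)
  also have "\<dots> \<le> (LINT y|?S. 2 * (p + q) * k * M z * (case y of (\<omega>, w) \<Rightarrow> M (w, x, t) * b (v - w) \<omega>))"
  proof (rule integral_mono)
    show "integrable ?S (\<lambda>y. norm (collision_integrand b F z y - collision_integrand b G z y))"
      by (intro integrable_norm Bochner_Integration.integrable_diff collision_integrand_integrable[OF F] collision_integrand_integrable[OF G])
    show "integrable ?S (\<lambda>y. 2 * (p + q) * k * M z * (case y of (\<omega>, w) \<Rightarrow> M (w, x, t) * b (v - w) \<omega>))"
      by (intro integrable_mult_right loss_integral)
    fix y assume "y \<in> space ?S"
    then show "norm (collision_integrand b F z y - collision_integrand b G z y)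
        \<le> 2 * (p + q) * k * M z * (case y of (\<omega>, w) \<Rightarrow> M (w, x, t) * b (v - w) \<omega>)"
      using collision_integrand_diff_le[OF F G FG, of "fst y" v x t "snd y"] sphere_lborel_norm[of y]
      by (cases y) (simp add: z)
  qed
  also have "\<dots> = 2 * (p + q) * k * M z * attenuation \<beta> bbar M z"
    by (simp only: integral_mult_right_zero loss_integral(2) z)
  finally show ?thesis .
qed

lemma collision_weight: "collision b M z = 0"
proof -
  have "collision_integrand b M z y = 0" if "y \<in> space (sphere_measure \<Otimes>\<^sub>M lborel :: 'n phase measure)" for y
    using weight_balance[OF sphere_lborel_norm[OF that]]
    by (cases z; cases y) (simp add: collision_integrand_def)
  then show ?thesis
    unfolding collision_def by (subst Bochner_Integration.integral_cong[OF refl]) auto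
qed

lemma attenuation_along_flow:
  "(\<integral>\<^sup>+s. ennreal (attenuation \<beta> bbar M (along_flow (p, s))) \<partial>lborel) \<le> ennreal \<nu>"
proof -
  have "(\<integral>\<^sup>+s. ennreal (attenuation \<beta> bbar M (along_flow (p, s))) \<partial>lborel) \<le> nu \<beta> bbar M"
    \<comment> \<open>The characteristic is represented in the supremum by its point at time
      0.\<close>
    unfolding nu_def by (rule SUP_upper2[of "(fst p, snd p, 0)"]) (simp_all add: along_flow_def split_beta')
  then show ?thesis
    using nu_finite by (simp add: less_top)
qed

lemma collision_along_flow_measurable:
  assumes "F \<in> borel_measurable borel"
  shows "(\<lambda>s. collision b F (along_flow (p, s))) \<in> borel_measurable borel"
proof -
  have "(\<lambda>s. along_flow (p, s)) \<in> borel \<rightarrow>\<^sub>M borel"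
    by (intro borel_measurable_continuous_onI continuous_on_compose2[OF continuous_on_along_flow] continuous_intros) auto
  then show ?thesis
    by (rule measurable_compose[OF _ collision_measurable[OF assms]])
qed

lemma collision_diff_along_flow:
  assumes F: "dominated p F" and G: "dominated q G" and FG: "dominated k (\<lambda>z. F z - G z)"
  shows "(\<integral>\<^sup>+s. ennreal \<bar>collision b F (along_flow (y, s)) - collision b G (along_flow (y, s))\<bar> \<partial>lborel)
    \<le> ennreal (2 * (p + q) * k * \<nu> * at_time M 0 y)"
proof -
  define K where "K = 2 * (p + q) * k * at_time M 0 y"
  have "0 \<le> K"
    using dominatedD(2)[OF F] dominatedD(2)[OF G] dominatedD(2)[OF FG] weight_pos
    by (simp add: K_def at_time_def split_beta' less_imp_le)
  have am: "(\<lambda>s. attenuation \<beta> bbar M (along_flow (y, s))) \<in> borel_measurable borel"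
    by (rule measurable_compose[OF borel_measurable_continuous_onI attenuation_measurable])
      (auto intro!: continuous_on_compose2[OF continuous_on_along_flow] continuous_intros)
  have "(\<integral>\<^sup>+s. ennreal \<bar>collision b F (along_flow (y, s)) - collision b G (along_flow (y, s))\<bar> \<partial>lborel)
      \<le> (\<integral>\<^sup>+s. ennreal K * ennreal (attenuation \<beta> bbar M (along_flow (y, s))) \<partial>lborel)"
  proof (rule nn_integral_mono)
    fix s
    have "\<bar>collision b F (along_flow (y, s)) - collision b G (along_flow (y, s))\<bar>
        \<le> K * attenuation \<beta> bbar M (along_flow (y, s))"
      using collision_diff_le[OF F G FG, of "along_flow (y, s)"] by (simp only: K_def weight_along_flow)
    then show "ennreal \<bar>collision b F (along_flow (y, s)) - collision b G (along_flow (y, s))\<bar>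
        \<le> ennreal K * ennreal (attenuation \<beta> bbar M (along_flow (y, s)))"
      using \<open>0 \<le> K\<close> by (simp add: attenuation_nonneg ennreal_leI flip: ennreal_mult)
  qed
  also have "\<dots> = ennreal K * (\<integral>\<^sup>+s. ennreal (attenuation \<beta> bbar M (along_flow (y, s))) \<partial>lborel)"
    using am by (intro nn_integral_cmult) simp
  also have "\<dots> \<le> ennreal K * ennreal \<nu>"
    by (intro mult_left_mono attenuation_along_flow) simp
  also have "\<dots> = ennreal (2 * (p + q) * k * \<nu> * at_time M 0 y)"
    using \<open>0 \<le> K\<close> by (simp add: K_def mult_ac flip: ennreal_mult)
  finally show ?thesis .
qed

lemma collision_along_flow:
  assumes F: "dominated p F"
  shows "(\<integral>\<^sup>+s. ennreal \<bar>collision b F (along_flow (y, s))\<bar> \<partial>lborel) \<le> ennreal (2 * p * p * \<nu> * at_time M 0 y)"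
    and "integrable lborel (\<lambda>s. collision b F (along_flow (y, s)))"
proof -
  have z: "collision b (\<lambda>_. 0) z = 0" for z :: "'n phase_time" by (simp add: collision_def)
  show le: "(\<integral>\<^sup>+s. ennreal \<bar>collision b F (along_flow (y, s))\<bar> \<partial>lborel) \<le> ennreal (2 * p * p * \<nu> * at_time M 0 y)"
    using collision_diff_along_flow[OF F dominated_zero, of p y] F by (simp add: z)
  show "integrable lborel (\<lambda>s. collision b F (along_flow (y, s)))"
    by (rule integrableI_bounded)
      (use collision_along_flow_measurable[OF dominatedD(1)[OF F]] le in \<open>auto intro: le_less_trans\<close>)
qed

lemma collision_interval_diff_le:
  assumes F: "dominated p F" and G: "dominated q G" and FG: "dominated k (\<lambda>z. F z - G z)"
  shows "\<bar>(LBINT s=ereal t1..ereal t2. collision b F (along_flow (y, s)))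
      - (LBINT s=ereal t1..ereal t2. collision b G (along_flow (y, s)))\<bar> \<le> 2 * (p + q) * k * \<nu> * at_time M 0 y"
proof -
  have int: "interval_lebesgue_integrable lborel (ereal t1) (ereal t2) (\<lambda>s. collision b H (along_flow (y, s)))"
    if "dominated r H" for r H
    using collision_along_flow(2)[OF that, of y]
    by (auto simp: interval_lebesgue_integrable_def set_integrable_def simp del: real_scaleR_def
        intro!: integrable_mult_indicator)
  have "0 \<le> 2 * (p + q) * k * \<nu> * at_time M 0 y"
    using dominatedD(2)[OF F] dominatedD(2)[OF G] dominatedD(2)[OF FG] weight_pos
    by (simp add: at_time_def split_beta' less_imp_le)
  then show ?thesis
    using abs_interval_integral_le[OF _ collision_diff_along_flow[OF F G FG, of y], of t1 t2]
      collision_along_flow_measurable[OF dominatedD(1)[OF F], of y]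
      collision_along_flow_measurable[OF dominatedD(1)[OF G], of y]
    by (simp add: interval_lebesgue_integral_diff(2)[OF int[OF F] int[OF G]])
qed

section \<open>Local integrability\<close>

lemma free_flow_at_time: "free_flow t (at_time H t) p = H (along_flow (p, t))"
  by (simp add: free_flow_def at_time_def along_flow_def split_beta')

lemma weight_bounded_on_compact:
  assumes "compact (K :: 'n phase_time set)"
  obtains C where "0 \<le> C" "\<And>z. z \<in> K \<Longrightarrow> M z \<le> C"
proof -
  have "bounded (M ` K)"
    using compact_continuous_image[OF continuous_on_subset[OF weight_continuous subset_UNIV] assms]
    by (rule compact_imp_bounded)
  then obtain C where "0 < C" "\<forall>y\<in>M ` K. norm y \<le> C" by (auto simp: bounded_pos)
  then show ?thesis using that[of C] by force
qed

lemma dominated_locally_integrable: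
  assumes F: "dominated p F"
  shows "locally_integrable_on F UNIV"
  unfolding locally_integrable_on_def
proof (intro allI impI)
  fix K :: "'n phase_time set" assume K: "compact K \<and> K \<subseteq> UNIV"
  obtain C where C: "0 \<le> C" "\<And>z. z \<in> K \<Longrightarrow> M z \<le> C"
    using weight_bounded_on_compact K by metis
  show "set_integrable lborel K F"
    unfolding set_integrable_def
  proof (rule integrableI_bounded_set)
    show "K \<in> sets lborel" using K by (simp add: borel_compact)
    then show "(\<lambda>z. indicat_real K z *\<^sub>R F z) \<in> borel_measurable lborel"
      using dominatedD(1)[OF F] by simp
    show "emeasure lborel K < \<infinity>"
      using K emeasure_bounded_finite compact_imp_bounded by blast
    have "\<bar>F z\<bar> \<le> p * C" if "z \<in> K" for z
      using dominatedD(3)[OF F, of z] mult_left_mono[OF C(2)[OF that] dominatedD(2)[OF F]] by linarith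
    then show "AE z in lborel. z \<in> K \<longrightarrow> norm (indicat_real K z *\<^sub>R F z) \<le> p * C"
      by simp
  qed auto
qed

text \<open>The phase point at time 0 of the characteristic through \<open>z\<close>; together with
  the time coordinate it inverts \<open>along_flow\<close>.\<close>

definition foot :: "'n phase_time \<Rightarrow> 'n phase" where
  "foot z = (fst z, fst (snd z) - snd (snd z) *\<^sub>R fst z)"

lemma along_flow_foot [simp]: "along_flow (foot z, snd (snd z)) = z"
  by (cases z) (simp add: foot_def)

lemma foot_along_flow [simp]: "foot (along_flow (y, s)) = y"
  by (cases y) (simp add: foot_def)

lemma continuous_on_foot: "continuous_on S foot"
  unfolding foot_def by (intro continuous_intros)

text \<open>The locale bounds \<open>attenuation\<close> only through its time integrals along
  characteristics, not locally. In characteristic coordinates a compact \<open>K\<close> has a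
  compact set of feet, and over each foot the integral over all times is at most
  \<open>2 * p * p * \<nu> * C\<close>.\<close>

lemma collision_locally_integrable:
  assumes F: "dominated p F"
  shows "locally_integrable_on (collision b F) UNIV"
  unfolding locally_integrable_on_def
proof (intro allI impI)
  fix K :: "'n phase_time set" assume K: "compact K \<and> K \<subseteq> UNIV"
  have "compact (foot ` K)" using K by (intro compact_continuous_image continuous_on_foot) auto
  obtain C where C: "0 \<le> C" "\<And>z. z \<in> (\<lambda>y. (fst y, snd y, 0 :: real)) ` foot ` K \<Longrightarrow> M z \<le> C"
  proof (rule weight_bounded_on_compact)
    show "compact ((\<lambda>y. (fst y, snd y, 0 :: real)) ` foot ` K)"
      by (intro compact_continuous_image \<open>compact (foot ` K)\<close> continuous_intros)
  qed auto
  have Km: "K \<in> sets borel" using K by (simp add: borel_compact)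
  have cm[measurable]: "collision b F \<in> borel_measurable borel" by (rule collision_measurable[OF dominatedD(1)[OF F]])
  have km[measurable]: "(\<lambda>z. ennreal (norm (indicat_real K z *\<^sub>R collision b F z))) \<in> borel_measurable borel"
    using Km by measurable
  have "(\<integral>\<^sup>+z. ennreal (norm (indicat_real K z *\<^sub>R collision b F z)) \<partial>lborel)
      = (\<integral>\<^sup>+y. \<integral>\<^sup>+s. ennreal (norm (indicat_real K (along_flow (y, s)) *\<^sub>R collision b F (along_flow (y, s)))) \<partial>lborel \<partial>lborel)"
    by (rule nn_integral_along_flow[OF km, symmetric])
  also have "\<dots> \<le> (\<integral>\<^sup>+y. ennreal (2 * p * p * \<nu> * C) * indicator (foot ` K) y \<partial>lborel)"
  proof (rule nn_integral_mono)
    fix y :: "'n phase"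
    show "(\<integral>\<^sup>+s. ennreal (norm (indicat_real K (along_flow (y, s)) *\<^sub>R collision b F (along_flow (y, s)))) \<partial>lborel)
        \<le> ennreal (2 * p * p * \<nu> * C) * indicator (foot ` K) y"
    proof (cases "y \<in> foot ` K")
      case True
      have "(\<integral>\<^sup>+s. ennreal (norm (indicat_real K (along_flow (y, s)) *\<^sub>R collision b F (along_flow (y, s)))) \<partial>lborel)
          \<le> (\<integral>\<^sup>+s. ennreal \<bar>collision b F (along_flow (y, s))\<bar> \<partial>lborel)"
        by (intro nn_integral_mono ennreal_leI) (simp add: indicator_def)
      also have "\<dots> \<le> ennreal (2 * p * p * \<nu> * at_time M 0 y)" by (rule collision_along_flow(1)[OF F])
      also have "\<dots> \<le> ennreal (2 * p * p * \<nu> * C)"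
        using C(2)[of "(fst y, snd y, 0)"] True dominatedD(2)[OF F]
        by (intro ennreal_leI mult_left_mono) (auto simp: at_time_def split_beta')
      finally show ?thesis using True by simp
    next
      case False
      then have "along_flow (y, s) \<notin> K" for s using foot_along_flow[of y s] by (metis imageI)
      then show ?thesis by simp
    qed
  qed
  also have "\<dots> = ennreal (2 * p * p * \<nu> * C) * emeasure lborel (foot ` K)"
    using borel_compact[OF \<open>compact (foot ` K)\<close>] by (intro nn_integral_cmult_indicator) simp
  also have "\<dots> < \<infinity>"
    using emeasure_bounded_finite[OF compact_imp_bounded[OF \<open>compact (foot ` K)\<close>]]
    by (simp add: ennreal_mult_less_top)
  finally show "set_integrable lborel K (collision b F)"
    unfolding set_integrable_def using Km cm by (intro integrableI_bounded) auto
qed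

subsection \<open>The Duhamel map and uniqueness\<close>

definition near :: "real \<Rightarrow> ('n phase_time \<Rightarrow> real) \<Rightarrow> bool" where
  "near r F \<longleftrightarrow> F \<in> borel_measurable borel \<and> (\<forall>z. \<bar>F z - M z\<bar> \<le> r * M z)"

lemma nearD:
  assumes "near r F"
  shows "F \<in> borel_measurable borel" "\<bar>F z - M z\<bar> \<le> r * M z"
  using assms unfolding near_def by blast+

lemma near_dominated:
  assumes "near r F" "0 \<le> r"
  shows "dominated (1 + r) F" "dominated r (\<lambda>z. F z - M z)"
proof -
  have "\<bar>F z\<bar> \<le> (1 + r) * M z" for z
    using nearD(2)[OF assms(1), of z] weight_pos[of z] by (simp add: algebra_simps abs_if split: if_splits)
  then show "dominated (1 + r) F"
    using assms by (simp add: dominated_def near_def)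
  show "dominated r (\<lambda>z. F z - M z)"
    using assms unfolding dominated_def near_def by auto
qed

lemma weight_foot: "at_time M 0 (foot z) = M z"
  using weight_along_flow[of "foot z" "snd (snd z)"] by simp

text \<open>Duhamel's formula along the characteristic through \<open>z\<close>, where the
  transported initial datum is its value at the foot.\<close>

definition picard :: "('n phase \<Rightarrow> real) \<Rightarrow> ('n phase_time \<Rightarrow> real) \<Rightarrow> 'n phase_time \<Rightarrow> real" where
  "picard f F z = f (foot z) + (LBINT s=ereal 0..ereal (snd (snd z)). collision b F (along_flow (foot z, s)))"

lemma picard_measurable:
  assumes f[measurable]: "f \<in> borel_measurable borel" and F: "F \<in> borel_measurable borel"
  shows "picard f F \<in> borel_measurable borel"
proof -
  have [measurable]: "foot \<in> borel \<rightarrow>\<^sub>M borel"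
    by (rule borel_measurable_continuous_onI[OF continuous_on_foot])
  have "(\<lambda>y :: 'n phase_time \<times> real. along_flow (foot (fst y), snd y)) \<in> borel \<rightarrow>\<^sub>M borel"
    by (intro borel_measurable_continuous_onI continuous_on_compose2[OF continuous_on_along_flow]
        continuous_on_Pair continuous_on_compose2[OF continuous_on_foot] continuous_intros) auto
  from measurable_compose[OF this collision_measurable[OF F]]
  have [measurable]: "(\<lambda>y :: 'n phase_time \<times> real. collision b F (along_flow (foot (fst y), snd y)))
      \<in> borel_measurable (borel \<Otimes>\<^sub>M lborel)"
    unfolding measurable_cong_sets[OF sets_pair_measure_cong[OF refl sets_lborel] refl] by (simp only: borel_prod)
  have [measurable]: "(\<lambda>z :: 'n phase_time. snd (snd z)) \<in> borel_measurable borel"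
    by (intro borel_measurable_continuous_onI continuous_intros)
  show ?thesis
    unfolding picard_def interval_integral_eq_signed
  proof (intro borel_measurable_add lborel.borel_measurable_lebesgue_integral)
    show "(\<lambda>z. f (foot z)) \<in> borel_measurable borel" by measurable
    show "(\<lambda>(z, s). (if 0 < s \<and> s < snd (snd z) then 1 else if snd (snd z) < s \<and> s < 0 then - 1 else 0)
        * collision b F (along_flow (foot z, s))) \<in> borel_measurable (borel \<Otimes>\<^sub>M lborel)"
      unfolding split_beta' by measurable
  qed
qed

lemma picard_diff_le:
  assumes F: "near r F" and G: "near r G" and FG: "dominated k (\<lambda>z. F z - G z)" and r: "0 \<le> r"
  shows "\<bar>picard f F z - picard f G z\<bar> \<le> 4 * (1 + r) * \<nu> * k * M z"
  using collision_interval_diff_le[OF near_dominated(1)[OF F r] near_dominated(1)[OF G r] FG, of 0 "snd (snd z)" "foot z"]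
  by (simp add: picard_def weight_foot algebra_simps)

text \<open>Comparison of \<open>F\<close> with \<open>M\<close>, whose collision integral vanishes:
  \<open>p = 1 + r\<close>, \<open>q = 1\<close> and \<open>k = r\<close> give the term
  \<open>2 * (2 + r) * r * \<nu>\<close>, while \<open>\<delta>\<close> comes from the initial
  datum.\<close>

lemma picard_near:
  assumes f: "f \<in> borel_measurable borel" "\<And>y. \<bar>f y - at_time M 0 y\<bar> \<le> \<delta> * at_time M 0 y"
    and F: "near r F" and r: "0 \<le> r" "\<delta> + 2 * (2 + r) * r * \<nu> \<le> r"
  shows "near r (picard f F)"
  unfolding near_def
proof (intro conjI allI picard_measurable f nearD(1)[OF F])
  fix z
  have "\<bar>picard f F z - f (foot z)\<bar> \<le> 2 * (1 + r + 1) * r * \<nu> * M z"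
    using collision_interval_diff_le[OF near_dominated(1)[OF F r(1)] dominated_weight near_dominated(2)[OF F r(1)],
        of 0 "snd (snd z)" "foot z"]
    by (simp add: picard_def collision_weight weight_foot)
  moreover have "\<bar>f (foot z) - M z\<bar> \<le> \<delta> * M z"
    using f(2)[of "foot z"] by (simp add: weight_foot)
  ultimately have "\<bar>picard f F z - M z\<bar> \<le> (\<delta> + 2 * (2 + r) * r * \<nu>) * M z"
    by (simp add: algebra_simps)
  also have "\<dots> \<le> r * M z"
    using r(2) weight_pos[of z] by (intro mult_right_mono) auto
  finally show "\<bar>picard f F z - M z\<bar> \<le> r * M z" .
qed

text \<open>The iterates converge at every point rather than in a quotient space, so the limit is a
  Borel function that solves the equation everywhere.\<close>

lemma picard_fixed_point:
  assumes f: "f \<in> borel_measurable borel" "\<And>y. \<bar>f y - at_time M 0 y\<bar> \<le> \<delta> * at_time M 0 y"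
    and r: "0 \<le> r" "\<delta> + 2 * (2 + r) * r * \<nu> \<le> r" "4 * (1 + r) * \<nu> < 1"
  obtains F where "near r F" "picard f F = F"
proof -
  define \<theta> where "\<theta> = 4 * (1 + r) * \<nu>"
  have \<theta>: "0 \<le> \<theta>" "\<theta> < 1" using r by (simp_all add: \<theta>_def)
  define X where "X n = (picard f ^^ n) M" for n
  have X_Suc: "X (Suc n) = picard f (X n)" for n by (simp add: X_def)
  have X: "near r (X n)" for n
  proof (induction n)
    case 0
    then show ?case using r(1) weight_pos by (simp add: X_def near_def less_imp_le)
  next
    case (Suc n)
    then show ?case unfolding X_Suc by (rule picard_near[OF f _ r(1,2)])
  qed
  \<comment> \<open>Admitting every \<open>m\<close> at once replaces the summation of a geometric
    series: since \<open>X 0 = M\<close>, the case \<open>n = 0\<close> is just the invariance of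
    the ball.\<close>
  have Xd: "dominated (\<theta> ^ n * r) (\<lambda>z. X (n + m) z - X n z)" for n m
  proof (induction n)
    case 0
    then show ?case using near_dominated(2)[OF X r(1)] by (simp add: X_def)
  next
    case (Suc n)
    have "\<bar>X (Suc n + m) z - X (Suc n) z\<bar> \<le> \<theta> ^ Suc n * r * M z" for z
      using picard_diff_le[OF X X Suc r(1), of f z] by (simp add: X_Suc \<theta>_def mult_ac)
    then show ?case
      using nearD(1)[OF X[of "Suc n"]] nearD(1)[OF X[of "Suc n + m"]] \<theta>(1) r(1) by (simp add: dominated_def)
  qed
  have lim0: "(\<lambda>n. \<theta> ^ n * c) \<longlonglongrightarrow> 0" for c
    using tendsto_mult_left_zero[OF LIMSEQ_realpow_zero[OF \<theta>]] .
  have "convergent (\<lambda>n. X n z)" for z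
  proof (rule Cauchy_convergent, rule CauchyI')
    fix e :: real assume "0 < e"
    then have "\<forall>\<^sub>F n in sequentially. \<theta> ^ n * (r * M z) < e"
      using lim0 by (rule order_tendstoD(2)[rotated])
    then obtain N where N: "\<And>n. n \<ge> N \<Longrightarrow> \<theta> ^ n * (r * M z) < e" by (auto simp: eventually_sequentially)
    show "\<exists>N. \<forall>m\<ge>N. \<forall>n>m. dist (X m z) (X n z) < e"
    proof (intro exI allI impI)
      fix m n assume "N \<le> m" "m < n"
      then show "dist (X m z) (X n z) < e"
        using dominatedD(3)[OF Xd[of m "n - m"], of z] N[of m] by (simp add: dist_real_def abs_minus_commute mult.assoc)
    qed
  qed
  then obtain F where F: "\<And>z. (\<lambda>n. X n z) \<longlonglongrightarrow> F z"
    unfolding convergent_def by metis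
  have FX: "\<bar>F z - X n z\<bar> \<le> \<theta> ^ n * r * M z" for n z
  proof (rule LIMSEQ_le_const2)
    show "(\<lambda>m. \<bar>X (m + n) z - X n z\<bar>) \<longlonglongrightarrow> \<bar>F z - X n z\<bar>"
      by (intro tendsto_intros LIMSEQ_ignore_initial_segment F)
    show "\<exists>N. \<forall>m\<ge>N. \<bar>X (m + n) z - X n z\<bar> \<le> \<theta> ^ n * r * M z"
      using dominatedD(3)[OF Xd[of n]] by (auto simp: add.commute)
  qed
  have Fm: "F \<in> borel_measurable borel"
    by (rule borel_measurable_LIMSEQ_real[OF F]) (rule nearD(1)[OF X])
  have nearF: "near r F"
    using Fm FX[of _ 0] by (simp add: near_def X_def)
  have "picard f F z = F z" for z
  proof (rule LIMSEQ_unique)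
    show "(\<lambda>n. X (Suc n) z) \<longlonglongrightarrow> F z" by (rule LIMSEQ_Suc[OF F])
    have "\<bar>X (Suc n) z - picard f F z\<bar> \<le> \<theta> ^ n * (\<theta> * r * M z)" for n
    proof -
      have "dominated (\<theta> ^ n * r) (\<lambda>z. X n z - F z)"
        using FX[of _ n] Fm nearD(1)[OF X[of n]] \<theta>(1) r(1) by (simp add: dominated_def abs_minus_commute)
      from picard_diff_le[OF X nearF this r(1), of f z] show ?thesis
        by (simp add: X_Suc \<theta>_def mult_ac)
    qed
    then have "(\<lambda>n. X (Suc n) z - picard f F z) \<longlonglongrightarrow> 0"
      by (intro Lim_null_comparison[OF _ lim0[of "\<theta> * r * M z"]]) (simp add: eventually_sequentially)
    then show "(\<lambda>n. X (Suc n) z) \<longlonglongrightarrow> picard f F z"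
      by (simp add: LIM_zero_iff)
  qed
  then have "picard f F = F" by blast
  with nearF that show ?thesis by blast
qed

section \<open>From the integral equation to mild solutions and back\<close>

text \<open>As the equation holds at every point, the mild identity holds on every characteristic
  for all times. Only the initial datum \<open>Fin\<close> is attained almost everywhere, through
  \<open>f\<close>.\<close>

lemma solution_near_fixed_point:
  assumes F: "near r F" "picard f F = F" and f: "AE y in lborel. f y = Fin y" and r: "0 \<le> r"
  shows "solution_near b M Fin r F"
proof -
  note dom = near_dominated[OF F(1) r]
  have [measurable]: "F \<in> borel_measurable borel" by (rule nearD(1)[OF F(1)])
  have eq: "F (along_flow (y, t)) = f y + (LBINT s=ereal 0..ereal t. collision b F (along_flow (y, s)))" for y t
  proof -
    have "F (along_flow (y, t)) = picard f F (along_flow (y, t))" by (simp add: F(2))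
    also have "\<dots> = f y + (LBINT s=ereal 0..ereal t. collision b F (along_flow (y, s)))"
      by (cases y) (simp add: picard_def del: along_flow_apply, simp)
    finally show ?thesis .
  qed
  have int: "interval_lebesgue_integrable lborel a c (\<lambda>s. collision b F (along_flow (y, s)))" for a c y
    using collision_along_flow(2)[OF dom(1), of y]
    by (auto simp: interval_lebesgue_integrable_def set_integrable_def simp del: real_scaleR_def
        intro!: integrable_mult_indicator)
  have "F (along_flow (y, t2)) = F (along_flow (y, t1)) + (LBINT s=ereal t1..ereal t2. collision b F (along_flow (y, s)))" for y t1 t2
    using interval_integral_sum[where a="ereal 0" and b="ereal t1" and c="ereal t2", OF int, of y] by (simp add: eq)
  then have "mild_solution b UNIV F"
    unfolding mild_solution_def
    using dominated_locally_integrable[OF dom(1)] collision_locally_integrable[OF dom(1)] collision_integrand_integrable[OF dom(1)]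
    by (simp add: free_flow_at_time)
  moreover have "F \<in> weighted_Linf M"
    by (rule weighted_normI(1)[of _ _ "1 + r"]) (use dominatedD[OF dom(1)] weight_pos in auto)
  moreover have "weighted_norm M (\<lambda>z. F z - M z) \<le> r"
    by (rule weighted_normI(2)) (use dominatedD[OF dom(2)] weight_pos r in auto)
  moreover have "AE y in lborel. at_time F 0 y = Fin y"
  proof -
    have "at_time F 0 y = f y" for y
      using eq[of y 0] by (cases y) (simp add: at_time_def zero_ereal_def)
    then show ?thesis using f by simp
  qed
  ultimately show ?thesis by (simp add: solution_near_def)
qed

lemma collision_AE_cong:
  assumes F: "F \<in> borel_measurable borel" and G: "G \<in> borel_measurable borel" and eq: "AE z in lborel. F z = G z"
  shows "AE z in lborel. collision b F z = collision b G z"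
  using collision_integrand_AE_cong[OF bhat_measurable F G eq, of \<beta>]
proof eventually_elim
  case (elim z)
  then show ?case
    unfolding collision_def
    by (intro integral_cong_AE collision_integrand_measurable_snd F G)
qed

text \<open>The collision integrals of \<open>F\<close> and of its dominated version
  \<open>F'\<close> agree at almost every time on almost every characteristic, which suffices under
  the time integral. The left side keeps \<open>F\<close> itself, for which the identity holds at
  all times.\<close>

lemma solution_near_duhamel:
  assumes F: "solution_near b M Fin r F" and F': "dominated p F'" "AE z in lborel. F z = F' z"
  shows "AE y in lborel. \<forall>t. F (along_flow (y, t)) = Fin y + (LBINT s=ereal 0..ereal t. collision b F' (along_flow (y, s)))"
proof -
  have Fm: "F \<in> borel_measurable borel" using F by (simp add: solution_near_def weighted_Linf_def)
  have mild: "AE y in lborel. \<forall>t1 t2. F (along_flow (y, t2)) = F (along_flow (y, t1))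
      + (LBINT s=ereal t1..ereal t2. collision b F (along_flow (y, s)))"
    using F by (simp add: solution_near_def mild_solution_def free_flow_at_time)
  have init: "AE y in lborel. at_time F 0 y = Fin y" using F by (simp add: solution_near_def)
  have "AE y in lborel. AE s in lborel. collision b F (along_flow (y, s)) = collision b F' (along_flow (y, s))"
    by (rule AE_along_flow[OF collision_AE_cong[OF Fm dominatedD(1)[OF F'(1)] F'(2)]])
  with mild init show ?thesis
  proof eventually_elim
    case (elim y)
    show ?case
    proof
      fix t
      have "(LBINT s=ereal 0..ereal t. collision b F (along_flow (y, s)))
          = (LBINT s=ereal 0..ereal t. collision b F' (along_flow (y, s)))"
        using elim(3) by (intro interval_integral_cong_AE collision_along_flow_measurable Fm dominatedD(1)[OF F'(1)]) auto
      moreover have "F (along_flow (y, 0)) = Fin y"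
        using elim(2) by (cases y) (simp add: at_time_def)
      ultimately show "F (along_flow (y, t)) = Fin y + (LBINT s=ereal 0..ereal t. collision b F' (along_flow (y, s)))"
        using elim(1)[rule_format, of t 0] by simp
    qed
  qed
qed

text \<open>Membership of \<open>F - M\<close> in \<open>weighted_Linf\<close> is derived first,
  because a bound on the real-valued \<open>weighted_norm\<close> does not by itself exclude an
  infinite essential supremum.\<close>

lemma solution_near_AE_bound:
  assumes F: "solution_near b M Fin r F"
  shows "AE z in lborel. \<bar>F z - M z\<bar> \<le> r * M z"
proof -
  have FL: "F \<in> weighted_Linf M" and le: "weighted_norm M (\<lambda>z. F z - M z) \<le> r"
    using F by (simp_all add: solution_near_def)
  have Fm[measurable]: "F \<in> borel_measurable borel" using FL by (simp add: weighted_Linf_def)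
  have "AE z in lborel. \<bar>F z - M z\<bar> \<le> (weighted_norm M F + 1) * M z"
    using weighted_normD[OF FL weight_pos]
  proof eventually_elim
    case (elim z)
    then show ?case using weight_pos[of z] by (simp add: algebra_simps)
  qed
  then have "(\<lambda>z. F z - M z) \<in> weighted_Linf M"
    using weight_pos weighted_norm_nonneg[of M F]
    by (intro weighted_normI(1)[where c="weighted_norm M F + 1"]) auto
  from weighted_normD[OF this weight_pos] show ?thesis
  proof eventually_elim
    case (elim z)
    then show ?case
      using mult_right_mono[OF le, of "M z"] weight_pos[of z] by linarith
  qed
qed

text \<open>Truncating both solutions to \<open>M\<close> on the null set where one of the bounds fails makes the
  bounds hold everywhere without changing the collision integrals almost everywhere.\<close>

lemma solution_near_contract:
  assumes F: "solution_near b M Fin r F" and G: "solution_near b M Fin r G" and r: "0 \<le> r" and k: "0 \<le> k"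
    and FG: "AE z in lborel. \<bar>F z - G z\<bar> \<le> k * M z"
  shows "AE z in lborel. \<bar>F z - G z\<bar> \<le> 4 * (1 + r) * \<nu> * k * M z"
proof -
  have [measurable]: "F \<in> borel_measurable borel" "G \<in> borel_measurable borel"
    using F G by (simp_all add: solution_near_def weighted_Linf_def)
  define good where "good z \<longleftrightarrow> \<bar>F z - M z\<bar> \<le> r * M z \<and> \<bar>G z - M z\<bar> \<le> r * M z \<and> \<bar>F z - G z\<bar> \<le> k * M z" for z
  define F' G' where "F' z = (if good z then F z else M z)" and "G' z = (if good z then G z else M z)" for z
  have [measurable]: "Measurable.pred borel good" unfolding good_def by measurable
  have [measurable]: "F' \<in> borel_measurable borel" "G' \<in> borel_measurable borel"
    unfolding F'_def G'_def by measurable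
  have nn: "0 \<le> r * M z" "0 \<le> k * M z" for z using r k weight_pos[of z] by simp_all
  then have "\<bar>F' z - M z\<bar> \<le> r * M z \<and> \<bar>G' z - M z\<bar> \<le> r * M z \<and> \<bar>F' z - G' z\<bar> \<le> k * M z" for z
    by (simp add: F'_def G'_def good_def)
  then have near: "near r F'" "near r G'" and dom: "dominated k (\<lambda>z. F' z - G' z)"
    using k by (simp_all add: near_def dominated_def)
  have "AE z in lborel. good z"
    using solution_near_AE_bound[OF F] solution_near_AE_bound[OF G] FG by eventually_elim (simp add: good_def)
  then have eq: "AE z in lborel. F z = F' z" "AE z in lborel. G z = G' z"
    by (auto elim!: eventually_mono simp: F'_def G'_def)
  show ?thesis
  proof (rule AE_of_along_flow)
    show "Measurable.pred borel (\<lambda>z. \<bar>F z - G z\<bar> \<le> 4 * (1 + r) * \<nu> * k * M z)" by measurable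
    show "AE y in lborel. \<forall>t. \<bar>F (along_flow (y, t)) - G (along_flow (y, t))\<bar> \<le> 4 * (1 + r) * \<nu> * k * M (along_flow (y, t))"
      using solution_near_duhamel[OF F near_dominated(1)[OF near(1) r] eq(1)]
        solution_near_duhamel[OF G near_dominated(1)[OF near(2) r] eq(2)]
    proof eventually_elim
      case (elim y)
      show ?case
      proof
        fix t
        show "\<bar>F (along_flow (y, t)) - G (along_flow (y, t))\<bar> \<le> 4 * (1 + r) * \<nu> * k * M (along_flow (y, t))"
          using collision_interval_diff_le[OF near_dominated(1)[OF near(1) r] near_dominated(1)[OF near(2) r] dom, of 0 t y]
          by (simp add: elim weight_along_flow algebra_simps)
      qed
    qed
  qed
qed

text \<open>The contraction is iterated from the crude bound \<open>2 * r\<close>, the distance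
  measured through \<open>M\<close>. A countable union of null sets then allows \<open>n\<close> to
  tend to infinity.\<close>

lemma solution_near_unique:
  assumes F: "solution_near b M Fin r F" and G: "solution_near b M Fin r G"
    and r: "0 \<le> r" "4 * (1 + r) * \<nu> < 1"
  shows "AE z in lborel. G z = F z"
proof -
  define \<theta> where "\<theta> = 4 * (1 + r) * \<nu>"
  have \<theta>: "0 \<le> \<theta>" "\<theta> < 1" using r by (simp_all add: \<theta>_def)
  have "AE z in lborel. \<bar>F z - G z\<bar> \<le> \<theta> ^ n * (2 * r) * M z" for n
  proof (induction n)
    case 0
    show ?case
      using solution_near_AE_bound[OF F] solution_near_AE_bound[OF G] by eventually_elim simp
  next
    case (Suc n)
    then show ?case
      using solution_near_contract[OF F G r(1) _ Suc] \<theta>(1) r(1) by (simp add: \<theta>_def mult_ac)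
  qed
  then have "AE z in lborel. \<forall>n. \<bar>F z - G z\<bar> \<le> \<theta> ^ n * (2 * r) * M z"
    by (simp add: AE_all_countable)
  then show ?thesis
  proof eventually_elim
    case (elim z)
    have "(\<lambda>n. \<theta> ^ n * (2 * r * M z)) \<longlonglongrightarrow> 0"
      by (rule tendsto_mult_left_zero[OF LIMSEQ_realpow_zero[OF \<theta>]])
    then have "\<bar>F z - G z\<bar> \<le> 0"
      using elim by (intro LIMSEQ_le_const[of _ 0]) (auto simp: mult.assoc)
    then show ?case by simp
  qed
qed

lemma ex1_solution_near:
  assumes Fin: "Fin \<in> weighted_Linf (at_time M 0)"
    and \<delta>: "weighted_norm (at_time M 0) (\<lambda>y. Fin y - at_time M 0 y) \<le> \<delta>"
    and r: "0 \<le> r" "\<delta> + 2 * (2 + r) * r * \<nu> \<le> r" "4 * (1 + r) * \<nu> < 1"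
  shows "\<exists>F. solution_near b M Fin r F \<and> (\<forall>G. solution_near b M Fin r G \<longrightarrow> (AE z in lborel. G z = F z))"
proof -
  have pos: "0 < at_time M 0 y" for y using weight_pos by (simp add: at_time_def split_beta')
  have "(\<lambda>y :: 'n phase. (fst y, snd y, 0 :: real)) \<in> borel \<rightarrow>\<^sub>M borel"
    by (intro borel_measurable_continuous_onI continuous_intros)
  from measurable_compose[OF this weight_measurable]
  have M0[measurable]: "at_time M 0 \<in> borel_measurable borel"
    by (simp add: at_time_def split_beta')
  have Finm[measurable]: "Fin \<in> borel_measurable borel" using Fin by (simp add: weighted_Linf_def)
  have "0 \<le> \<delta>" using \<delta> weighted_norm_nonneg order_trans by blast
  \<comment> \<open>\<open>Fin\<close> obeys the bound only almost everywhere; \<open>f\<close>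
    replaces it by the weight where the bound fails, so that the pointwise fixed-point argument
    applies.\<close>
  define W where "W y \<longleftrightarrow> \<bar>Fin y - at_time M 0 y\<bar> \<le> \<delta> * at_time M 0 y" for y
  define f where "f y = (if W y then Fin y else at_time M 0 y)" for y
  have [measurable]: "Measurable.pred borel W" unfolding W_def by measurable
  have fm: "f \<in> borel_measurable borel" unfolding f_def by measurable
  have fb: "\<bar>f y - at_time M 0 y\<bar> \<le> \<delta> * at_time M 0 y" for y
    using \<open>0 \<le> \<delta>\<close> pos[of y] by (simp add: f_def W_def)
  have "AE y in lborel. \<bar>Fin y - at_time M 0 y\<bar> \<le> (weighted_norm (at_time M 0) Fin + 1) * at_time M 0 y"
    using weighted_normD[OF Fin pos]
  proof eventually_elim
    case (elim y)
    then show ?case using pos[of y] by (simp add: algebra_simps)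
  qed
  then have "(\<lambda>y. Fin y - at_time M 0 y) \<in> weighted_Linf (at_time M 0)"
    using pos weighted_norm_nonneg[of "at_time M 0" Fin]
    by (intro weighted_normI(1)[where c="weighted_norm (at_time M 0) Fin + 1"]) auto
  from weighted_normD[OF this pos] have "AE y in lborel. f y = Fin y"
  proof eventually_elim
    case (elim y)
    then have "W y"
      unfolding W_def using mult_right_mono[OF \<delta>, of "at_time M 0 y"] pos[of y] by linarith
    then show ?case by (simp add: f_def)
  qed
  moreover obtain F where "near r F" "picard f F = F"
    using picard_fixed_point[OF fm fb r] .
  ultimately have "solution_near b M Fin r F"
    using solution_near_fixed_point r(1) by blast
  then show ?thesis
    using solution_near_unique r(1,3) by blast
qed

end

section \<open>The kernel, the radius and the Maxwellian of the theorem\<close>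

text \<open>\<open>sphere_measure\<close> lives on unit vectors, so kernel values at other
  \<open>\<omega>\<close> are never seen. This permits replacing \<open>bhat\<close>, controlled
  only on \<open>{-1..1}\<close>, by a function that is Borel on the whole line.\<close>

lemma solution_near_kernel_cong:
  fixes b b' :: "real ^ 'n \<Rightarrow> real ^ 'n \<Rightarrow> real"
  assumes "\<And>z \<omega>. norm \<omega> = 1 \<Longrightarrow> b z \<omega> = b' z \<omega>"
  shows "solution_near b M Fin r F \<longleftrightarrow> solution_near b' M Fin r F"
proof -
  have eq: "collision_integrand b F z p = collision_integrand b' F z p"
    if "p \<in> space (sphere_measure \<Otimes>\<^sub>M lborel :: 'n phase measure)" for z p
    using that assms by (cases z; cases p) (auto simp: collision_integrand_def space_pair_measure)
  then have "collision b F = collision b' F"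
    unfolding collision_def by (intro ext Bochner_Integration.integral_cong refl)
  moreover have "integrable (sphere_measure \<Otimes>\<^sub>M lborel) (collision_integrand b F z)
      \<longleftrightarrow> integrable (sphere_measure \<Otimes>\<^sub>M lborel) (collision_integrand b' F z)" for z
    by (intro Bochner_Integration.integrable_cong refl eq)
  ultimately show ?thesis
    by (simp add: solution_near_def mild_solution_def)
qed

text \<open>With \<open>e = 1 - 4 * \<nu>\<close>, the number \<open>r\<close> is the smaller root
  of \<open>2 * \<nu> * r\<^sup>2 - e * r + \<delta> = 0\<close>, whose discriminant is positive by
  the bound on \<open>\<delta>\<close>. The derivative of the polynomial at this root is
  \<open>- (e * S)\<close>, and its strict negativity is the contraction condition.\<close>

lemma smaller_root_bounds:
  fixes \<nu> \<delta> r :: real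
  assumes \<nu>: "0 < \<nu>" "4 * \<nu> < 1" and \<delta>: "0 \<le> \<delta>" "\<delta> < (1 - 4 * \<nu>)\<^sup>2 / (8 * \<nu>)"
    and r: "r = (1 / (4 * \<nu>) - 1) * (1 - sqrt (1 - 8 * \<nu> * \<delta> / (1 - 4 * \<nu>)\<^sup>2))"
  shows "0 \<le> r" "\<delta> + 2 * (2 + r) * r * \<nu> = r" "4 * (1 + r) * \<nu> < 1"
    and "1 / 2 \<le> 4 * \<nu> \<or> \<delta> \<le> 1 - 6 * \<nu> \<Longrightarrow> r \<le> 1"
proof -
  define e d where "e = 1 - 4 * \<nu>" and "d = 8 * \<nu> * \<delta> / e\<^sup>2"
  define S where "S = sqrt (1 - d)"
  have e: "0 < e" using \<nu> by (simp add: e_def)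
  have d: "0 \<le> d" "d < 1"
    using \<nu> \<delta> e by (simp_all add: d_def pos_divide_less_eq pos_less_divide_eq flip: e_def) (simp add: mult_ac)
  have S: "0 < S" "S \<le> 1" "S\<^sup>2 = 1 - d" using d by (simp_all add: S_def)
  have "1 / (4 * \<nu>) - 1 = e / (4 * \<nu>)" using \<nu> by (simp add: e_def field_simps)
  then have rS: "r = e / (4 * \<nu>) * (1 - S)" by (simp add: r S_def d_def e_def)
  then have r4: "4 * \<nu> * r = e * (1 - S)" using \<nu> by simp
  show "0 \<le> r" using rS S e \<nu> by simp
  have "4 * (1 + r) * \<nu> = 1 - e * S"
    using r4 by (simp add: e_def algebra_simps)
  then show "4 * (1 + r) * \<nu> < 1" using e S by simp
  have "8 * \<nu> * (\<delta> + 2 * (2 + r) * r * \<nu> - r) = 8 * \<nu> * \<delta> + (4 * \<nu> * r)\<^sup>2 - 2 * e * (4 * \<nu> * r)"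
    by (simp add: e_def power2_eq_square algebra_simps)
  also have "\<dots> = 8 * \<nu> * \<delta> + e\<^sup>2 * (S\<^sup>2 - 1)"
    unfolding r4 by (simp add: power2_eq_square algebra_simps)
  also have "\<dots> = 0" unfolding S(3) using e by (simp add: d_def)
  finally show "\<delta> + 2 * (2 + r) * r * \<nu> = r" using \<nu> by simp
  show "r \<le> 1" if "1 / 2 \<le> 4 * \<nu> \<or> \<delta> \<le> 1 - 6 * \<nu>"
  proof -
    \<comment> \<open>This is equivalent to \<open>r \<le> 1\<close>. The left side is not positive
      when \<open>1 / 2 \<le> 4 * \<nu>\<close>; otherwise squaring turns the inequality into
      \<open>\<delta> \<le> 1 - 6 * \<nu>\<close>, which explains that threshold.\<close>
    have "e - 4 * \<nu> \<le> e * S"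
      using that
    proof
      assume "1 / 2 \<le> 4 * \<nu>"
      then have "e - 4 * \<nu> \<le> 0" by (simp add: e_def)
      also have "0 \<le> e * S" using e S by simp
      finally show ?thesis .
    next
      assume "\<delta> \<le> 1 - 6 * \<nu>"
      then have "8 * \<nu> * \<delta> \<le> 8 * \<nu> * (1 - 6 * \<nu>)" using \<nu> by simp
      moreover have "(e * S)\<^sup>2 = e\<^sup>2 - 8 * \<nu> * \<delta>"
        unfolding power_mult_distrib S(3) using e by (simp add: d_def algebra_simps)
      ultimately have "(e - 4 * \<nu>)\<^sup>2 \<le> (e * S)\<^sup>2"
        by (simp add: e_def power2_eq_square algebra_simps)
      moreover have "0 \<le> e * S" using e S by simp
      ultimately show ?thesis by (rule power2_le_imp_le)
    qed
    then have "4 * \<nu> * r \<le> 4 * \<nu> * 1" unfolding r4 by (simp add: algebra_simps)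
    then show ?thesis using \<nu> by simp
  qed
qed

text \<open>Orthogonal invariance moves the angular integral from \<open>n\<close> to every
  direction; balance and moments come from the Gaussian form at fixed \<open>(x, t)\<close>.\<close>

lemma global_maxwellian_dominating_weight:
  fixes M :: "'n::finite phase_time \<Rightarrow> real" and bhat :: "real \<Rightarrow> real" and n :: "real ^ 'n"
  assumes beta: "- real CARD('n) < \<beta>"
    and bhat[measurable]: "bhat \<in> borel_measurable borel" "\<And>y. 0 \<le> bhat y"
    and n: "norm n = 1" and int: "integrable sphere_measure (\<lambda>\<omega>. bhat (\<omega> \<bullet> n))"
    and bbar: "bbar = (LINT \<omega>|sphere_measure. bhat (\<omega> \<bullet> n))"
    and M: "global_maxwellian M" and nu: "nu \<beta> bbar M < \<infinity>" "nu \<beta> bbar M \<noteq> 0"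
  shows "dominating_weight \<beta> bbar bhat M"
proof -
  obtain m a b c B v0 x0 where pos: "0 < m" "0 < a" "0 < c" and B: "skew_symmetric B"
    and Q: "positive_definite (maxwellian_Q a b c B)" and M_def: "M = maxwellian m a b c B v0 x0"
    using M unfolding global_maxwellian_def by blast
  define \<kappa> where "\<kappa> = m / (2 * pi) ^ CARD('n) * sqrt (det (maxwellian_Q a b c B))"
  have bbar_nonneg: "0 \<le> bbar" unfolding bbar by (intro integral_nonneg_AE) (simp add: bhat)
  have M_exp: "M (v, x, t) = \<kappa> * exp (- maxwellian_q a b c B (v - v0) (x - x0 - t *\<^sub>R v0) t)" for v x t
    by (simp add: M_def maxwellian_def \<kappa>_def)
  have gauss: "\<exists>\<sigma> l k. 0 < \<sigma> \<and> (\<forall>v. M (v, x, t) = \<kappa> * (exp (- k) * exp (- (\<sigma> / 2 * (norm (v - v0))\<^sup>2 + (v - v0) \<bullet> l))))" for x t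
    using maxwellian_gaussian[OF pos(2) B Q, of m v0 x0 x t] by (simp add: M_def \<kappa>_def)
  \<comment> \<open>\<open>\<nu> \<noteq> 0\<close> excludes \<open>det Q \<le> 0\<close>, so the sign of the determinant need not be computed.\<close>
  have "0 < \<kappa>"
  proof (rule ccontr)
    assume "\<not> 0 < \<kappa>"
    then have "M (v, x, t) \<le> 0" for v x t by (simp add: M_exp mult_nonpos_nonneg)
    then have "0 \<le> (LINT w|lborel. - (M (w, x, t) * norm (v - w) powr \<beta>))" for v x t
      by (intro integral_nonneg_AE) (simp add: mult_nonpos_nonneg)
    then have "(LINT w|lborel. M (w, x, t) * norm (v - w) powr \<beta>) \<le> 0" for v x t by simp
    then have "attenuation \<beta> bbar M z \<le> 0" for z
      using bbar_nonneg by (cases z) (simp add: attenuation_def mult_nonneg_nonpos)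
    then have "nu \<beta> bbar M = 0"
      by (simp add: nu_def ennreal_neg split_beta')
    with nu(2) show False by simp
  qed
  have bal: "M (v - ((v - w) \<bullet> \<omega>) *\<^sub>R \<omega>, x, t) * M (w + ((v - w) \<bullet> \<omega>) *\<^sub>R \<omega>, x, t) = M (v, x, t) * M (w, x, t)"
    if "norm \<omega> = 1" for v w x :: "real ^ 'n" and t and \<omega> :: "real ^ 'n"
  proof -
    obtain \<sigma> l k where g: "\<And>v. M (v, x, t) = \<kappa> * (exp (- k) * exp (- (\<sigma> / 2 * (norm (v - v0))\<^sup>2 + (v - v0) \<bullet> l)))"
      using gauss[of x t] by blast
    define y where "y = (v - w) \<bullet> \<omega>"
    have "\<omega> \<bullet> \<omega> = 1" using that by (simp flip: power2_norm_eq_inner)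
    \<comment> \<open>Conservation of energy relative to \<open>v0\<close>; together with
      conservation of momentum in the linear term it balances the exponents.\<close>
    then have "(norm (v - y *\<^sub>R \<omega> - v0))\<^sup>2 + (norm (w + y *\<^sub>R \<omega> - v0))\<^sup>2 = (norm (v - v0))\<^sup>2 + (norm (w - v0))\<^sup>2"
      unfolding power2_norm_eq_inner
      by (simp add: inner_diff inner_add inner_commute y_def algebra_simps)
    then have "\<sigma> / 2 * (norm (v - y *\<^sub>R \<omega> - v0))\<^sup>2 + \<sigma> / 2 * (norm (w + y *\<^sub>R \<omega> - v0))\<^sup>2
        = \<sigma> / 2 * (norm (v - v0))\<^sup>2 + \<sigma> / 2 * (norm (w - v0))\<^sup>2"
      by (metis distrib_left)
    moreover have "(v - y *\<^sub>R \<omega> - v0) \<bullet> l + (w + y *\<^sub>R \<omega> - v0) \<bullet> l = (v - v0) \<bullet> l + (w - v0) \<bullet> l"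
      by (simp add: inner_diff_left inner_add_left)
    ultimately have "exp (- (\<sigma> / 2 * (norm (v - y *\<^sub>R \<omega> - v0))\<^sup>2 + (v - y *\<^sub>R \<omega> - v0) \<bullet> l))
        * exp (- (\<sigma> / 2 * (norm (w + y *\<^sub>R \<omega> - v0))\<^sup>2 + (w + y *\<^sub>R \<omega> - v0) \<bullet> l))
        = exp (- (\<sigma> / 2 * (norm (v - v0))\<^sup>2 + (v - v0) \<bullet> l)) * exp (- (\<sigma> / 2 * (norm (w - v0))\<^sup>2 + (w - v0) \<bullet> l))"
      unfolding exp_add[symmetric] by (intro arg_cong[where f=exp]) linarith
    then show ?thesis
      unfolding g y_def[symmetric] by (simp add: mult_ac)
  qed
  show ?thesis
  proof
    show "(\<integral>\<^sup>+\<omega>. ennreal (bhat (\<omega> \<bullet> e)) \<partial>sphere_measure) = ennreal bbar" if "norm e = 1" for e :: "real ^ 'n"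
    proof -
      have "(\<integral>\<^sup>+\<omega>. ennreal (bhat (\<omega> \<bullet> e)) \<partial>sphere_measure) = (\<integral>\<^sup>+\<omega>. ennreal (bhat (\<omega> \<bullet> n)) \<partial>sphere_measure)"
        by (rule nn_integral_sphere_measure_unit_indep[OF _ n that]) simp
      also have "\<dots> = ennreal bbar"
        unfolding bbar by (rule nn_integral_eq_integral[OF int]) (simp add: bhat)
      finally show ?thesis .
    qed
    show "0 < M z" for z by (cases z) (simp add: M_exp \<open>0 < \<kappa>\<close>)
    show "continuous_on UNIV M" unfolding M_def by (rule continuous_on_maxwellian)
    show "M (v, x + s *\<^sub>R v, t + s) = M (v, x, t)" for v x s t
      unfolding M_def by (rule maxwellian_transport)
    show "integrable lborel (\<lambda>w. M (w, x, t) * norm (v - w) powr \<beta>)" for v x t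
    proof -
      obtain \<sigma> l k where g: "0 < \<sigma>" "\<And>v. M (v, x, t) = \<kappa> * (exp (- k) * exp (- (\<sigma> / 2 * (norm (v - v0))\<^sup>2 + (v - v0) \<bullet> l)))"
        using gauss[of x t] by blast
      have "integrable lborel (\<lambda>w. (\<kappa> * exp (- k)) * (exp (- (\<sigma> / 2 * (norm (w - v0))\<^sup>2 + (w - v0) \<bullet> l)) * norm (v - w) powr \<beta>))"
        using beta by (intro integrable_mult_right integrable_gaussian_norm_powr[OF g(1)]) simp
      then show ?thesis unfolding g(2) by (simp only: mult.assoc)
    qed
  qed (use bhat bbar_nonneg bal nu in auto)
qed

theorem theorem2p1:
  fixes \<beta> bbar \<nu> \<delta> r :: real
    and bhat :: "real \<Rightarrow> real"
    and b :: "real ^ 'n \<Rightarrow> real ^ 'n \<Rightarrow> real"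
    and n :: "real ^ 'n"
    and M :: "'n::finite phase_time \<Rightarrow> real"
    and Fin :: "'n::finite phase \<Rightarrow> real"
  assumes beta: "1 - real CARD('n) < \<beta>" "\<beta> \<le> 1"
    and bhat_measurable: "bhat \<in> borel_measurable (restrict_space borel {-1..1})"
    and bhat_nonneg: "\<And>y. y \<in> {-1..1} \<Longrightarrow> 0 \<le> bhat y"
    and unit: "norm n = 1"
    and bhat_integrable: "integrable sphere_measure (\<lambda>\<omega>. bhat (\<omega> \<bullet> n))"
    and bbar: "bbar = (LINT \<omega>|sphere_measure. bhat (\<omega> \<bullet> n))" "0 < bbar"
    and kernel: "b = separated_kernel \<beta> bhat"
    and M: "global_maxwellian M"
    and nu_small: "nu \<beta> bbar M < ennreal (1/4)"
    and nu: "\<nu> = enn2real (nu \<beta> bbar M)"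
    and Fin: "Fin \<in> weighted_Linf (at_time M 0)"
    and delta: "\<delta> = weighted_norm (at_time M 0) (\<lambda>p. Fin p - at_time M 0 p)"
    and small: "\<delta> < (1 - 4 * \<nu>)\<^sup>2 / (8 * \<nu>)"
    and r: "r = (1 / (4 * \<nu>) - 1) * (1 - sqrt (1 - 8 * \<nu> * \<delta> / (1 - 4 * \<nu>)\<^sup>2))"
  shows "(\<exists>F. solution_near b M Fin r F \<and>
      (\<forall>G. solution_near b M Fin r G \<longrightarrow> (AE z in lborel. G z = F z))) \<and>
    ((1/2 \<le> 4 * \<nu> \<and> 4 * \<nu> < 1) \<or> (0 < 4 * \<nu> \<and> 4 * \<nu> < 1/2 \<and> \<delta> \<le> 1 - 6 * \<nu>) \<longrightarrow>
      r \<le> 1 \<and>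
      (\<forall>F. solution_near b M Fin r F \<longrightarrow> (AE z in lborel.
        0 \<le> (1 - r) * M z \<and> (1 - r) * M z \<le> F z \<and> F z \<le> (1 + r) * M z)))"
proof -
  \<comment> \<open>Extension by zero makes the angular profile Borel and nonnegative on the whole
    line. The kernel is unchanged for unit \<open>\<omega>\<close>, since
    \<open>\<omega> \<bullet> sgn z\<close> lies in \<open>{-1..1}\<close>.\<close>
  define bhat0 where "bhat0 y = indicator {-1..1} y *\<^sub>R bhat y" for y
  have bhat0: "bhat0 \<in> borel_measurable borel" "\<And>y. 0 \<le> bhat0 y"
    using bhat_measurable bhat_nonneg
    by (simp_all add: bhat0_def[abs_def] borel_measurable_restrict_space_iff indicator_def)
  have bhat0_eq: "bhat (\<omega> \<bullet> y) = bhat0 (\<omega> \<bullet> y)" if "norm \<omega> = 1" "norm y \<le> 1" for \<omega> y :: "real ^ 'n"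
  proof -
    have "\<bar>\<omega> \<bullet> y\<bar> \<le> 1" using Cauchy_Schwarz_ineq2[of \<omega> y] that by simp
    then show ?thesis by (simp add: bhat0_def indicator_def abs_le_iff)
  qed
  have near_eq: "solution_near b M Fin r F \<longleftrightarrow> solution_near (separated_kernel \<beta> bhat0) M Fin r F" for F
    unfolding kernel
    by (rule solution_near_kernel_cong) (simp add: separated_kernel_def bhat0_eq norm_sgn)
  have int0: "integrable sphere_measure (\<lambda>\<omega>. bhat0 (\<omega> \<bullet> n))"
    using bhat_integrable unit by (subst Bochner_Integration.integrable_cong[OF refl, of _ _ "\<lambda>\<omega>. bhat (\<omega> \<bullet> n)"]) (auto simp: bhat0_eq)
  have bbar0: "bbar = (LINT \<omega>|sphere_measure. bhat0 (\<omega> \<bullet> n))"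
    unfolding bbar(1) using unit by (intro Bochner_Integration.integral_cong) (auto simp: bhat0_eq)
  have \<delta>: "0 \<le> \<delta>" unfolding delta by (rule weighted_norm_nonneg)
  \<comment> \<open>For \<open>\<nu> = 0\<close> the bound on \<open>\<delta>\<close> would be \<open>x / 0 = 0\<close>.\<close>
  have "\<nu> \<noteq> 0" using small \<delta> by auto
  moreover have fin: "nu \<beta> bbar M < \<infinity>" using nu_small by (rule less_trans) simp
  moreover have "\<nu> < 1/4"
  proof -
    have "ennreal \<nu> < ennreal (1/4)" using nu_small fin by (simp add: nu)
    moreover have "0 \<le> \<nu>" by (simp add: nu)
    ultimately show ?thesis using ennreal_less_iff by blast
  qed
  ultimately have \<nu>: "0 < \<nu>" "4 * \<nu> < 1" "nu \<beta> bbar M \<noteq> 0"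
    using enn2real_nonneg[of "nu \<beta> bbar M"] by (auto simp: nu simp del: enn2real_nonneg)
  interpret dominating_weight \<beta> bbar bhat0 M
    using beta bhat0 unit int0 bbar0 M fin \<nu>(3) by (intro global_maxwellian_dominating_weight) auto
  note bounds = smaller_root_bounds[OF \<nu>(1,2) \<delta> small r]
  have "\<exists>F. solution_near b M Fin r F \<and> (\<forall>G. solution_near b M Fin r G \<longrightarrow> (AE z in lborel. G z = F z))"
    unfolding near_eq
    by (rule ex1_solution_near[OF Fin]) (use bounds delta nu in \<open>auto simp: mult_ac\<close>)
  moreover have "AE z in lborel. 0 \<le> (1 - r) * M z \<and> (1 - r) * M z \<le> F z \<and> F z \<le> (1 + r) * M z"
    if "r \<le> 1" "solution_near b M Fin r F" for F
    using solution_near_AE_bound[OF that(2)[unfolded near_eq]]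
  proof eventually_elim
    case (elim z)
    then show ?case
      using that(1) weight_pos[of z] by (simp add: abs_le_iff algebra_simps)
  qed
  ultimately show ?thesis using bounds(4) by blast
qed

end
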